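(* Let $q(x^{(1)},x^{(2)},y^{(1)},y^{(2)},z^{(1)},z^{(2)})$ be a joint distribution on finite sets (so $Z^{(1)},Z^{(2)}$ are arbitrarily jointly distributed with $X^{(1)},X^{(2)},Y^{(1)},Y^{(2)}$). Suppose the rate pair $(R_{12},R_{21})$ is admissible with $r_1$ rounds of communication for the problem with node observations $X^{(1)},X^{(2)}$ and targets $Z^{(1)},Z^{(2)}$ (distribution $q(x^{(1)},x^{(2)},z^{(1)},z^{(2)})$), and the rate pair $(R'_{12},R'_{21})$ is admissible with $r_2$ rounds of communication for the problem in which node 1 observes $(X^{(1)},Z^{(1)})$, node 2 observes $(X^{(2)},Z^{(2)})$, and the targets are $Y^{(1)},Y^{(2)}$ (distribution $q(x^{(1)}z^{(1)},x^{(2)}z^{(2)},y^{(1)},y^{(2)})$). Then the rate pair $(R_{12}+R'_{12},R_{21}+R'_{21})$ is admissible with $r_1+r_2$ rounds of communication for the problem with observations $X^{(1)},X^{(2)}$ and targets $Y^{(1)},Y^{(2)}$ (distribution $q(x^{(1)},x^{(2)},y^{(1)},y^{(2)})$).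
   Context: Two-node coordination problem. For a joint pmf $q(a^{(1)},a^{(2)},b^{(1)},b^{(2)})$ on finite sets (node $i$ observes $A^{(i)}$ and must generate $B^{(i)}$) and a natural number $r$, a code of blocklength $n$ with $r$ interactive rounds is: node 1 observes $A^{(1)}_{1:n}$, node 2 observes $A^{(2)}_{1:n}$, with $(A^{(1)}_i,A^{(2)}_i)_{i=1}^n$ i.i.d. according to the $(A^{(1)},A^{(2)})$-marginal of $q$; node $i$ has private randomness $M_i$, with $M_1,M_2,(A^{(1)}_{1:n},A^{(2)}_{1:n})$ mutually independent; no common randomness. Messages $C_1,\dots,C_r$ satisfy $H(C_j\mid C_{1:j-1}A^{(1)}_{1:n}M_1)=0$ for odd $j$, $H(C_j\mid C_{1:j-1}A^{(2)}_{1:n}M_2)=0$ for even $j$, $\frac1n\sum_{j\text{ odd}}H(C_j)\le R_{12}$, $\frac1n\sum_{j\text{ even}}H(C_j)\le R_{21}$. Node 1 outputs $\widehat B^{(1)}_{1:n}$ as a function of $(A^{(1)}_{1:n},M_1,C_{1:r})$ and node 2 outputs $\widehat B^{(2)}_{1:n}$ as a function of $(A^{(2)}_{1:n},M_2,C_{1:r})$. $(R_{12},R_{21})$ is admissible with $r$ rounds if for every $\epsilon>0$ there is $n_0$ such that for all $n\ge n_0$ such a code exists with total variation ($\ell_1$) distance at most $\epsilon$ between the law of $(A^{(1)}_{1:n},A^{(2)}_{1:n},\widehat B^{(1)}_{1:n},\widehat B^{(2)}_{1:n})$ and that of $n$ i.i.d. copies of $(A^{(1)},A^{(2)},B^{(1)},B^{(2)})\sim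 q$. *)

theory Defs
  imports "HOL-Probability.Probability"
begin

fun iid :: "nat \<Rightarrow> 'a pmf \<Rightarrow> 'a list pmf" where
  "iid 0 p = return_pmf []"
| "iid (Suc n) p = bind_pmf p (\<lambda>x. map_pmf (\<lambda>xs. x # xs) (iid n p))"

definition unzip4 :: "('a \<times> 'b \<times> 'c \<times> 'd) list \<Rightarrow> 'a list \<times> 'b list \<times> 'c list \<times> 'd list" where
  "unzip4 xs = (map fst xs, map (fst \<circ> snd) xs, map (fst \<circ> snd \<circ> snd) xs, map (snd \<circ> snd \<circ> snd) xs)"

definition entropy_pmf :: "'a pmf \<Rightarrow> ereal" where
  "entropy_pmf p = enn2ereal (\<integral>\<^sup>+ x. ennreal (- pmf p x * log 2 (pmf p x)) \<partial>count_space UNIV)"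

definition l1_dist :: "'a pmf \<Rightarrow> 'a pmf \<Rightarrow> real" where
  "l1_dist p p' = infsum (\<lambda>x. \<bar>pmf p x - pmf p' x\<bar>) UNIV"

text \<open>The transcript C_1 ... C_j: odd-indexed messages are computed by node 1 from
  (its observations, its private randomness, previous messages), even-indexed ones by node 2.
  Messages take values in a countable alphabet (encoded as nat).\<close>
fun transcript ::
  "(nat \<Rightarrow> 'a1 list \<Rightarrow> 'm \<Rightarrow> nat list \<Rightarrow> nat) \<Rightarrow> (nat \<Rightarrow> 'a2 list \<Rightarrow> 'm \<Rightarrow> nat list \<Rightarrow> nat) \<Rightarrow>
   'a1 list \<Rightarrow> 'a2 list \<Rightarrow> 'm \<Rightarrow> 'm \<Rightarrow> nat \<Rightarrow> nat list" where
  "transcript f1 f2 a1 a2 m1 m2 0 = []"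
| "transcript f1 f2 a1 a2 m1 m2 (Suc j) =
     (let cs = transcript f1 f2 a1 a2 m1 m2 j
      in cs @ [if odd (Suc j) then f1 (Suc j) a1 m1 cs else f2 (Suc j) a2 m2 cs])"

text \<open>Joint law of (source block, M1, M2): mutually independent, source i.i.d. from the
  (A1,A2)-marginal of q. Private randomness is discrete (a pmf on nat).\<close>
definition joint_exp ::
  "('a1 \<times> 'a2 \<times> 'b1 \<times> 'b2) pmf \<Rightarrow> nat \<Rightarrow> nat pmf \<Rightarrow> nat pmf \<Rightarrow> (('a1 \<times> 'a2) list \<times> nat \<times> nat) pmf" where
  "joint_exp q n P1 P2 =
     pair_pmf (iid n (map_pmf (\<lambda>(a1, a2, b1, b2). (a1, a2)) q)) (pair_pmf P1 P2)"

definition msg_law ::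
  "('a1 \<times> 'a2 \<times> 'b1 \<times> 'b2) pmf \<Rightarrow> nat \<Rightarrow> nat pmf \<Rightarrow> nat pmf \<Rightarrow>
   (nat \<Rightarrow> 'a1 list \<Rightarrow> nat \<Rightarrow> nat list \<Rightarrow> nat) \<Rightarrow> (nat \<Rightarrow> 'a2 list \<Rightarrow> nat \<Rightarrow> nat list \<Rightarrow> nat) \<Rightarrow>
   nat \<Rightarrow> nat \<Rightarrow> nat pmf" where
  "msg_law q n P1 P2 f1 f2 r j =
     map_pmf (\<lambda>(as, m1, m2). transcript f1 f2 (map fst as) (map snd as) m1 m2 r ! (j - 1))
       (joint_exp q n P1 P2)"

definition out_law ::
  "('a1 \<times> 'a2 \<times> 'b1 \<times> 'b2) pmf \<Rightarrow> nat \<Rightarrow> nat pmf \<Rightarrow> nat pmf \<Rightarrow>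
   (nat \<Rightarrow> 'a1 list \<Rightarrow> nat \<Rightarrow> nat list \<Rightarrow> nat) \<Rightarrow> (nat \<Rightarrow> 'a2 list \<Rightarrow> nat \<Rightarrow> nat list \<Rightarrow> nat) \<Rightarrow>
   ('a1 list \<Rightarrow> nat \<Rightarrow> nat list \<Rightarrow> 'b1 list) \<Rightarrow> ('a2 list \<Rightarrow> nat \<Rightarrow> nat list \<Rightarrow> 'b2 list) \<Rightarrow>
   nat \<Rightarrow> ('a1 list \<times> 'a2 list \<times> 'b1 list \<times> 'b2 list) pmf" where
  "out_law q n P1 P2 f1 f2 g1 g2 r =
     map_pmf (\<lambda>(as, m1, m2).
        let a1 = map fst as; a2 = map snd as; cs = transcript f1 f2 a1 a2 m1 m2 r
        in (a1, a2, g1 a1 m1 cs, g2 a2 m2 cs))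
       (joint_exp q n P1 P2)"

text \<open>(R12,R21) admissible with r rounds for the coordination problem q.
  Rate constraints: (1/n) sum_{j odd} H(C_j) <= R12, (1/n) sum_{j even} H(C_j) <= R21,
  written multiplied by n.\<close>
definition admissible :: "('a1 \<times> 'a2 \<times> 'b1 \<times> 'b2) pmf \<Rightarrow> nat \<Rightarrow> real \<Rightarrow> real \<Rightarrow> bool" where
  "admissible q r R12 R21 \<longleftrightarrow>
     (\<forall>\<epsilon>>0. \<exists>n0. \<forall>n\<ge>n0. \<exists>P1 P2 f1 f2 g1 g2.
        (\<Sum>j\<in>{j\<in>{1..r}. odd j}. entropy_pmf (msg_law q n P1 P2 f1 f2 r j)) \<le> ereal (real n * R12) \<and>
        (\<Sum>j\<in>{j\<in>{1..r}. even j}. entropy_pmf (msg_law q n P1 P2 f1 f2 r j)) \<le> ereal (real n * R21) \<and>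
        l1_dist (out_law q n P1 P2 f1 f2 g1 g2 r) (map_pmf unzip4 (iid n q)) \<le> \<epsilon>)"

end

theory Submission
  imports Defs
begin

text \<open>The code for \<open>Z\<close> is run first and its outputs are fed, in place of the true \<open>Z\<close>, into the code
  for \<open>Y\<close>. Total variation distance does not increase under the kernel given by the second code.
  The difficulty is that the rate bounds have no slack while the entropies of the second
  code's messages change when its input law is perturbed, possibly without bound since the alphabet
  is infinite. Therefore the second code first decides with a small probability to abort, which makes
  room in the rate, and it also aborts when a message is too unlikely under its nominal law. Gibbs'
  inequality with respect to the nominal law then bounds the entropies of the perturbed messages.
  If the first code has an odd number of rounds, its last message and the first message of the second
  code are sent together.\<close>

section \<open>Entropy and variation distance\<close>

text \<open>For a node with entropy budget H, the robust code spends at most r (1 + B \<eta>) + (1 -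
  \<delta>) H bits: one bit per message to tell abort from data, B \<eta> for a perturbation of size
  \<eta> acting on surprisals truncated at B, and the factor 1 - \<delta> from the sender's coin.
  This fits into H as soon as \<delta> H \<ge> r (1 + B \<eta>). By Markov's inequality the
  truncation is rarely active when B is large against the sum of both budgets. The budgets grow like
  n, so B may do so too, and \<eta> can be fixed independently of n: \<delta> comes from \<epsilon>,
  B / n from \<delta>, \<eta> from both, and only then are the first code and a large n chosen. A
  budget 0 offers no room at all and needs a separate argument.\<close>

definition entropy_nn :: "'a pmf \<Rightarrow> ennreal" where
  "entropy_nn p = (\<integral>\<^sup>+ x. ennreal (- log 2 (pmf p x)) \<partial>measure_pmf p)"

lemma entropy_pmf_eq: "entropy_pmf p = enn2ereal (entropy_nn p)"
proof -
  have "ennreal (- pmf p x * log 2 (pmf p x)) = ennreal (pmf p x) * ennreal (- log 2 (pmf p x))" for x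
    by (simp flip: ennreal_mult')
  thus ?thesis
    by (simp add: entropy_pmf_def entropy_nn_def nn_integral_measure_pmf)
qed

lemma sum_entropy_le_iff:
  assumes "0 \<le> H"
  shows "(\<Sum>j\<in>J. entropy_pmf (p j)) \<le> ereal H \<longleftrightarrow> (\<Sum>j\<in>J. entropy_nn (p j)) \<le> ennreal H"
proof -
  have "(\<Sum>j\<in>J. entropy_pmf (p j)) = enn2ereal (\<Sum>j\<in>J. entropy_nn (p j))"
    by (simp add: entropy_pmf_eq)
  moreover have "ereal H = enn2ereal (ennreal H)"
    using assms by (simp add: enn2ereal_ennreal)
  ultimately show ?thesis
    by (simp add: less_eq_ennreal.rep_eq)
qed

text \<open>This is ln t \<le> t - 1 at t = s x / p x, averaged over \<open>p\<close>. The constant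
  \<open>c\<close>, which converts natural to binary logarithms, is added on both sides so that no
  subtraction occurs in \<open>ennreal\<close>.\<close>

lemma gibbs_inequality:
  fixes s :: "'a \<Rightarrow> real"
  assumes pos: "\<And>x. x \<in> set_pmf p \<Longrightarrow> 0 < s x"
    and le1: "\<And>x. x \<in> set_pmf p \<Longrightarrow> s x \<le> 1"
    and sub: "(\<integral>\<^sup>+ x. ennreal (s x) \<partial>count_space UNIV) \<le> 1"
  shows "entropy_nn p \<le> (\<integral>\<^sup>+ x. ennreal (- log 2 (s x)) \<partial>measure_pmf p)"
proof -
  define c where "c = 1 / ln (2::real)"
  have c: "c > 0" by (simp add: c_def)
  have "entropy_nn p + ennreal c = (\<integral>\<^sup>+ x. ennreal (- log 2 (pmf p x)) + ennreal c \<partial>measure_pmf p)"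
    by (simp add: entropy_nn_def nn_integral_add)
  also have "\<dots> \<le> (\<integral>\<^sup>+ x. ennreal (- log 2 (s x)) + ennreal (c * (s x / pmf p x)) \<partial>measure_pmf p)"
  proof (rule nn_integral_mono_AE, rule AE_pmfI)
    fix x assume x: "x \<in> set_pmf p"
    have px: "pmf p x > 0" and p1: "pmf p x \<le> 1"
      using x by (simp_all add: pmf_positive pmf_le_1)
    have sx: "s x > 0" "s x \<le> 1" using pos le1 x by auto
    have "ln (s x / pmf p x) \<le> s x / pmf p x - 1"
      by (rule ln_le_minus_one) (use px sx in simp)
    hence "c * (ln (s x) - ln (pmf p x)) \<le> c * (s x / pmf p x - 1)"
      using px sx c by (intro mult_left_mono) (simp_all add: ln_div)
    hence "- log 2 (pmf p x) + c \<le> - log 2 (s x) + c * (s x / pmf p x)"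
      by (simp add: log_def c_def field_simps)
    moreover have "- log 2 (pmf p x) \<ge> 0" "- log 2 (s x) \<ge> 0"
      using px p1 sx by simp_all
    ultimately show "ennreal (- log 2 (pmf p x)) + ennreal c
        \<le> ennreal (- log 2 (s x)) + ennreal (c * (s x / pmf p x))"
      using c px sx by (simp flip: ennreal_plus add: ennreal_leI)
  qed
  also have "\<dots> = (\<integral>\<^sup>+ x. ennreal (- log 2 (s x)) \<partial>measure_pmf p)
      + (\<integral>\<^sup>+ x. ennreal (c * (s x / pmf p x)) \<partial>measure_pmf p)"
    by (simp add: nn_integral_add)
  also have "(\<integral>\<^sup>+ x. ennreal (c * (s x / pmf p x)) \<partial>measure_pmf p)
      = (\<integral>\<^sup>+ x. ennreal (pmf p x) * ennreal (c * (s x / pmf p x)) \<partial>count_space UNIV)"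
    by (simp add: nn_integral_measure_pmf)
  also have "\<dots> \<le> (\<integral>\<^sup>+ x. ennreal c * ennreal (s x) \<partial>count_space UNIV)"
  proof (rule nn_integral_mono)
    fix x
    show "ennreal (pmf p x) * ennreal (c * (s x / pmf p x)) \<le> ennreal c * ennreal (s x)"
    proof (cases "x \<in> set_pmf p")
      case True
      thus ?thesis using c pos[OF True] pmf_positive[OF True]
        by (simp flip: ennreal_mult')
    qed (simp add: set_pmf_iff)
  qed
  also have "\<dots> \<le> ennreal c * 1"
    using mult_left_mono[OF sub, of "ennreal c"] by (simp add: nn_integral_cmult)
  finally have "entropy_nn p + ennreal c \<le> (\<integral>\<^sup>+ x. ennreal (- log 2 (s x)) \<partial>measure_pmf p) + ennreal c"
    by (simp add: add_left_mono)
  thus ?thesis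
    by (simp add: add.commute[of _ "ennreal c"] ennreal_add_left_cancel_le)
qed

lemma nn_integral_pmf_UNIV: "(\<integral>\<^sup>+ x. ennreal (pmf p x) \<partial>count_space UNIV) = 1"
  using nn_integral_measure_pmf[of p "\<lambda>_. 1"] by simp

text \<open>Subadditivity of entropy: Gibbs' inequality with the product of the two marginals as
  reference law.\<close>

lemma entropy_pair_le:
  "entropy_nn (map_pmf (\<lambda>w. prod_encode (f w, g w)) p)
     \<le> entropy_nn (map_pmf f p) + entropy_nn (map_pmf g p)"
proof -
  define A B where "A = map_pmf f p" and "B = map_pmf g p"
  define Q where "Q = map_pmf prod_encode (pair_pmf A B)"
  have Q: "pmf Q (prod_encode (a, b)) = pmf A a * pmf B b" for a b
    unfolding Q_def by (subst pmf_map_inj') (simp_all add: inj_prod_encode pmf_pair)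
  have pos: "pmf A (f w) > 0 \<and> pmf B (g w) > 0" if "w \<in> set_pmf p" for w
    using that by (auto simp: A_def B_def intro!: pmf_positive)
  have "entropy_nn (map_pmf (\<lambda>w. prod_encode (f w, g w)) p) \<le>
      (\<integral>\<^sup>+ x. ennreal (- log 2 (pmf Q x)) \<partial>map_pmf (\<lambda>w. prod_encode (f w, g w)) p)"
    by (rule gibbs_inequality) (auto simp: nn_integral_pmf_UNIV pmf_le_1 Q pos)
  also have "\<dots> = (\<integral>\<^sup>+ w. ennreal (- log 2 (pmf A (f w) * pmf B (g w))) \<partial>p)"
    by (simp add: Q)
  also have "\<dots> = (\<integral>\<^sup>+ w. ennreal (- log 2 (pmf A (f w))) + ennreal (- log 2 (pmf B (g w))) \<partial>p)"
  proof (rule nn_integral_cong_AE, rule AE_pmfI)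
    fix w assume "w \<in> set_pmf p"
    with pos have "pmf A (f w) > 0" "pmf B (g w) > 0" by auto
    moreover from this have "- log 2 (pmf A (f w)) \<ge> 0" "- log 2 (pmf B (g w)) \<ge> 0"
      by (simp_all add: pmf_le_1)
    ultimately show "ennreal (- log 2 (pmf A (f w) * pmf B (g w)))
        = ennreal (- log 2 (pmf A (f w))) + ennreal (- log 2 (pmf B (g w)))"
      by (simp add: log_mult flip: ennreal_plus)
  qed
  also have "\<dots> = entropy_nn A + entropy_nn B"
    by (simp add: nn_integral_add entropy_nn_def A_def B_def)
  finally show ?thesis by (simp add: A_def B_def)
qed

lemma entropy_return [simp]: "entropy_nn (return_pmf c) = 0"
  by (simp add: entropy_nn_def)

text \<open>Every point of the support has surprisal 0, hence mass 1.\<close>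

lemma entropy_eq_0_imp_return:
  assumes "entropy_nn p = 0"
  shows "\<exists>c. p = return_pmf c"
proof -
  have "AE x in measure_pmf p. ennreal (- log 2 (pmf p x)) = 0"
    using assms by (simp add: entropy_nn_def nn_integral_0_iff_AE)
  hence *: "\<forall>x\<in>set_pmf p. ennreal (- log 2 (pmf p x)) = 0"
    by (simp add: AE_measure_pmf_iff)
  obtain c where c: "c \<in> set_pmf p" using set_pmf_not_empty by fast
  hence "- log 2 (pmf p c) \<le> 0" using * by (simp add: ennreal_eq_0_iff)
  hence "pmf p c \<ge> 1" using pmf_positive[OF c] by simp
  hence "pmf p c = 1" using pmf_le_1[of p c] by linarith
  hence "AE x in measure_pmf p. x \<in> {c}"
    by (intro measure_pmf.AE_prob_1) (simp add: measure_pmf_single)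
  hence "set_pmf p \<subseteq> {c}" by (auto simp: AE_measure_pmf_iff)
  hence "p = return_pmf c" by (simp add: set_pmf_subset_singleton)
  thus ?thesis ..
qed

section \<open>Variation distance: data processing and coupling\<close>

lemma ennreal_l1_dist:
  "ennreal (l1_dist p p') = (\<integral>\<^sup>+ x. ennreal \<bar>pmf p x - pmf p' x\<bar> \<partial>count_space UNIV)"
proof -
  have i: "integrable (count_space UNIV) (\<lambda>x. \<bar>pmf p x - pmf p' x\<bar>)"
    by (intro integrable_abs Bochner_Integration.integrable_diff integrable_pmf)
  have "l1_dist p p' = infsetsum (\<lambda>x. \<bar>pmf p x - pmf p' x\<bar>) UNIV"
    unfolding l1_dist_def using i
    by (intro infsetsum_infsum[symmetric]) (simp add: Infinite_Set_Sum.abs_summable_on_def)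
  also have "\<dots> = (\<integral>x. \<bar>pmf p x - pmf p' x\<bar> \<partial>count_space UNIV)"
    by (simp add: infsetsum_def)
  finally show ?thesis
    using nn_integral_eq_integral[OF i] by simp
qed

lemma l1_dist_nonneg: "0 \<le> l1_dist p p'"
  unfolding l1_dist_def by (rule infsum_nonneg) simp

lemma l1_dist_triangle: "l1_dist p r \<le> l1_dist p q + l1_dist q r"
proof -
  have "ennreal (l1_dist p r) \<le>
     (\<integral>\<^sup>+ x. ennreal \<bar>pmf p x - pmf q x\<bar> + ennreal \<bar>pmf q x - pmf r x\<bar> \<partial>count_space UNIV)"
    unfolding ennreal_l1_dist
    by (intro nn_integral_mono) (simp flip: ennreal_plus add: ennreal_leI)
  also have "\<dots> = ennreal (l1_dist p q + l1_dist q r)"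
    by (simp add: nn_integral_add ennreal_l1_dist[symmetric] l1_dist_nonneg)
  finally show ?thesis
    by (subst (asm) ennreal_le_iff) (simp_all add: l1_dist_nonneg)
qed

text \<open>Change of measure for a bounded function, from p' \<le> p + \<bar>p' - p\<bar>
  pointwise. It will be applied to truncated surprisals.\<close>

lemma expectation_le_l1:
  fixes \<phi> :: "'a \<Rightarrow> ennreal"
  assumes "\<And>x. \<phi> x \<le> b"
  shows "(\<integral>\<^sup>+ x. \<phi> x \<partial>measure_pmf p') \<le> (\<integral>\<^sup>+ x. \<phi> x \<partial>measure_pmf p) + b * ennreal (l1_dist p' p)"
proof -
  have "(\<integral>\<^sup>+ x. \<phi> x \<partial>measure_pmf p') = (\<integral>\<^sup>+ x. ennreal (pmf p' x) * \<phi> x \<partial>count_space UNIV)"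
    by (simp add: nn_integral_measure_pmf)
  also have "\<dots> \<le> (\<integral>\<^sup>+ x. ennreal (pmf p x) * \<phi> x + b * ennreal \<bar>pmf p' x - pmf p x\<bar> \<partial>count_space UNIV)"
  proof (rule nn_integral_mono)
    fix x
    have "ennreal (pmf p' x) \<le> ennreal (pmf p x) + ennreal \<bar>pmf p' x - pmf p x\<bar>"
      by (simp flip: ennreal_plus add: ennreal_leI)
    hence "ennreal (pmf p' x) * \<phi> x \<le> (ennreal (pmf p x) + ennreal \<bar>pmf p' x - pmf p x\<bar>) * \<phi> x"
      by (rule mult_right_mono) simp
    also have "\<dots> \<le> ennreal (pmf p x) * \<phi> x + b * ennreal \<bar>pmf p' x - pmf p x\<bar>"
      using assms[of x] by (simp add: distrib_right mult.commute[of b] mult_left_mono)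
    finally show "ennreal (pmf p' x) * \<phi> x \<le> \<dots>" .
  qed
  also have "\<dots> = (\<integral>\<^sup>+ x. \<phi> x \<partial>measure_pmf p) + b * ennreal (l1_dist p' p)"
    by (simp add: nn_integral_add nn_integral_cmult nn_integral_measure_pmf ennreal_l1_dist)
  finally show ?thesis .
qed

text \<open>Data processing: bound each point by the triangle inequality, then exchange the sums and
  use that every \<open>K x\<close> has mass 1.\<close>

lemma l1_dist_bind: "l1_dist (bind_pmf p K) (bind_pmf p' K) \<le> l1_dist p p'"
proof -
  have one: "ennreal \<bar>pmf (bind_pmf p K) y - pmf (bind_pmf p' K) y\<bar>
     \<le> (\<integral>\<^sup>+ x. ennreal \<bar>pmf p x - pmf p' x\<bar> * ennreal (pmf (K x) y) \<partial>count_space UNIV)" (is "_ \<le> ?I y") for y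
  proof -
    have aux: "ennreal (pmf (bind_pmf p K) y) \<le> ennreal (pmf (bind_pmf p' K) y) +
       (\<integral>\<^sup>+ x. ennreal \<bar>pmf p x - pmf p' x\<bar> * ennreal (pmf (K x) y) \<partial>count_space UNIV)" for p p'
    proof -
      have "ennreal (pmf (bind_pmf p K) y) = (\<integral>\<^sup>+ x. ennreal (pmf p x) * ennreal (pmf (K x) y) \<partial>count_space UNIV)"
        by (simp add: ennreal_pmf_bind nn_integral_measure_pmf)
      also have "\<dots> \<le> (\<integral>\<^sup>+ x. ennreal (pmf p' x) * ennreal (pmf (K x) y)
          + ennreal \<bar>pmf p x - pmf p' x\<bar> * ennreal (pmf (K x) y) \<partial>count_space UNIV)"
        by (intro nn_integral_mono)
          (simp flip: distrib_right ennreal_plus add: ennreal_leI mult_right_mono)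
      also have "\<dots> = ennreal (pmf (bind_pmf p' K) y) +
       (\<integral>\<^sup>+ x. ennreal \<bar>pmf p x - pmf p' x\<bar> * ennreal (pmf (K x) y) \<partial>count_space UNIV)"
        by (simp add: nn_integral_add ennreal_pmf_bind nn_integral_measure_pmf)
      finally show ?thesis .
    qed
    have sym: "\<bar>pmf p x - pmf p' x\<bar> = \<bar>pmf p' x - pmf p x\<bar>" for x by simp
    show ?thesis
    \<comment> \<open>An infinite majorant makes the claim trivial. A finite one lets the two
      one-sided bounds pass to the reals and combine into an absolute value.\<close>
    proof (cases "?I y")
      case (real i)
      have "pmf (bind_pmf p K) y \<le> pmf (bind_pmf p' K) y + i"
        using aux[of p p'] real by (simp flip: ennreal_plus)
      moreover have "pmf (bind_pmf p' K) y \<le> pmf (bind_pmf p K) y + i"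
        using aux[of p' p] real by (simp add: sym flip: ennreal_plus)
      ultimately show ?thesis using real by (simp add: ennreal_leI abs_le_iff)
    qed simp
  qed
  have "ennreal (l1_dist (bind_pmf p K) (bind_pmf p' K)) \<le> (\<integral>\<^sup>+ y. ?I y \<partial>count_space UNIV)"
    unfolding ennreal_l1_dist by (intro nn_integral_mono one)
  also have "\<dots> = (\<integral>\<^sup>+ x. \<integral>\<^sup>+ y. ennreal \<bar>pmf p x - pmf p' x\<bar> * ennreal (pmf (K x) y) \<partial>count_space UNIV \<partial>count_space UNIV)"
    using nn_integral_fst_count_space[of "\<lambda>(x,y). ennreal \<bar>pmf p x - pmf p' x\<bar> * ennreal (pmf (K x) y)"]
      nn_integral_snd_count_space[of "\<lambda>(x,y). ennreal \<bar>pmf p x - pmf p' x\<bar> * ennreal (pmf (K x) y)"]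
    by simp
  also have "\<dots> = ennreal (l1_dist p p')"
    by (simp add: nn_integral_cmult nn_integral_pmf_UNIV ennreal_l1_dist)
  finally show ?thesis by (simp add: l1_dist_nonneg)
qed

lemma l1_dist_map: "l1_dist (map_pmf f p) (map_pmf f p') \<le> l1_dist p p'"
  unfolding map_pmf_def by (rule l1_dist_bind)

text \<open>Coupling bound: at each value the two masses differ only by points of \<open>E\<close>.
  The fibres of \<open>f\<close>, and likewise those of \<open>g\<close>, partition
  \<open>E\<close>, so its probability is counted twice.\<close>

lemma l1_dist_map_neq:
  assumes "\<And>x. x \<in> set_pmf p \<Longrightarrow> x \<notin> E \<Longrightarrow> f x = g x"
  shows "l1_dist (map_pmf f p) (map_pmf g p) \<le> 2 * measure_pmf.prob p E"
proof -
  have pt: "ennreal \<bar>pmf (map_pmf f p) y - pmf (map_pmf g p) y\<bar>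
     \<le> emeasure p (E \<inter> f -` {y}) + emeasure p (E \<inter> g -` {y})" for y
  proof -
    have aux: "measure p (f -` {y}) \<le> measure p (g -` {y}) + measure p (E \<inter> f -` {y})"
      if "\<And>x. x \<in> set_pmf p \<Longrightarrow> x \<notin> E \<Longrightarrow> f x = g x" for f g
    proof -
      have "measure p (f -` {y}) \<le> measure p (g -` {y} \<union> (E \<inter> f -` {y}))"
        using that by (intro measure_pmf.finite_measure_mono_AE) (auto simp: AE_measure_pmf_iff)
      also have "\<dots> \<le> measure p (g -` {y}) + measure p (E \<inter> f -` {y})"
        by (rule measure_Un_le) auto
      finally show ?thesis .
    qed
    have "\<bar>pmf (map_pmf f p) y - pmf (map_pmf g p) y\<bar> \<le> measure p (E \<inter> f -` {y}) + measure p (E \<inter> g -` {y})"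
      using aux[of f g, OF assms] aux[of g f, OF assms[symmetric]]
        measure_nonneg[of p "E \<inter> f -` {y}"] measure_nonneg[of p "E \<inter> g -` {y}"]
      unfolding pmf_map by linarith
    thus ?thesis
      by (simp add: measure_pmf.emeasure_eq_measure ennreal_leI flip: ennreal_plus)
  qed
  have sum: "(\<integral>\<^sup>+ y. emeasure p (E \<inter> h -` {y}) \<partial>count_space UNIV) = emeasure p E" for h :: "'a \<Rightarrow> 'b"
  proof -
    have "(\<integral>\<^sup>+ y. emeasure p (E \<inter> h -` {y}) \<partial>count_space UNIV)
       = (\<integral>\<^sup>+ y. \<integral>\<^sup>+ x. ennreal (pmf p x) * indicator (E \<inter> h -` {y}) x \<partial>count_space UNIV \<partial>count_space UNIV)"
      by (simp flip: nn_integral_indicator add: nn_integral_measure_pmf)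
    also have "\<dots> = (\<integral>\<^sup>+ x. \<integral>\<^sup>+ y. ennreal (pmf p x) * indicator (E \<inter> h -` {y}) x \<partial>count_space UNIV \<partial>count_space UNIV)"
      using nn_integral_fst_count_space[of "\<lambda>(x,y). ennreal (pmf p x) * indicator (E \<inter> h -` {y}) x"]
        nn_integral_snd_count_space[of "\<lambda>(x,y). ennreal (pmf p x) * indicator (E \<inter> h -` {y}) x"]
      by simp
    also have "\<dots> = (\<integral>\<^sup>+ x. ennreal (pmf p x) * indicator E x \<partial>count_space UNIV)"
    proof (rule nn_integral_cong)
      fix x
      have "(indicator (E \<inter> h -` {y}) x :: ennreal) = indicator E x * indicator {h x} y" for y
        by (auto simp: indicator_def)
      thus "(\<integral>\<^sup>+ y. ennreal (pmf p x) * indicator (E \<inter> h -` {y}) x \<partial>count_space UNIV)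
          = ennreal (pmf p x) * indicator E x"
        by (simp add: nn_integral_cmult flip: mult.assoc)
    qed
    also have "\<dots> = emeasure p E"
      by (simp flip: nn_integral_indicator add: nn_integral_measure_pmf)
    finally show ?thesis .
  qed
  have "ennreal (l1_dist (map_pmf f p) (map_pmf g p))
     \<le> (\<integral>\<^sup>+ y. emeasure p (E \<inter> f -` {y}) + emeasure p (E \<inter> g -` {y}) \<partial>count_space UNIV)"
    unfolding ennreal_l1_dist by (intro nn_integral_mono pt)
  also have "\<dots> = emeasure p E + emeasure p E"
    by (simp add: nn_integral_add sum)
  also have "\<dots> = ennreal (2 * measure_pmf.prob p E)"
    by (simp add: measure_pmf.emeasure_eq_measure flip: ennreal_plus)
  finally show ?thesis by simp
qed

section \<open>Robust codes\<close>

lemma length_transcript [simp]: "length (transcript f1 f2 a1 a2 m1 m2 k) = k"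
  by (induction k) (simp_all add: Let_def)

lemma transcript_Suc:
  "transcript f1 f2 a1 a2 m1 m2 (Suc j) = transcript f1 f2 a1 a2 m1 m2 j @
     [if even j then f1 (Suc j) a1 m1 (transcript f1 f2 a1 a2 m1 m2 j)
      else f2 (Suc j) a2 m2 (transcript f1 f2 a1 a2 m1 m2 j)]"
  by (simp add: Let_def)

declare transcript.simps(2) [simp del]

lemma take_transcript:
  "k \<le> r \<Longrightarrow> take k (transcript f1 f2 a1 a2 m1 m2 r) = transcript f1 f2 a1 a2 m1 m2 k"
  by (induction r) (auto simp: transcript_Suc le_Suc_eq)

lemma nth_transcript:
  assumes "i < r"
  shows "transcript f1 f2 a1 a2 m1 m2 r ! i =
    (if even i then f1 (Suc i) a1 m1 (transcript f1 f2 a1 a2 m1 m2 i)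
     else f2 (Suc i) a2 m2 (transcript f1 f2 a1 a2 m1 m2 i))"
proof -
  have "transcript f1 f2 a1 a2 m1 m2 r ! i = transcript f1 f2 a1 a2 m1 m2 (Suc i) ! i"
    using assms take_transcript[of "Suc i" r f1 f2 a1 a2 m1 m2]
    by (metis Suc_leI lessI nth_take)
  thus ?thesis by (simp add: transcript_Suc nth_append)
qed

text \<open>The source is an arbitrary law on pairs of blocks, since the second code will be run on
  simulated blocks that are not i.i.d.\<close>

definition run_msg ::
  "('a1 list \<times> 'a2 list) pmf \<Rightarrow> nat pmf \<Rightarrow> nat pmf \<Rightarrow>
   (nat \<Rightarrow> 'a1 list \<Rightarrow> nat \<Rightarrow> nat list \<Rightarrow> nat) \<Rightarrow> (nat \<Rightarrow> 'a2 list \<Rightarrow> nat \<Rightarrow> nat list \<Rightarrow> nat) \<Rightarrow>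
   nat \<Rightarrow> nat \<Rightarrow> nat pmf" where
  "run_msg S P1 P2 f1 f2 r j =
     map_pmf (\<lambda>((a1, a2), m1, m2). transcript f1 f2 a1 a2 m1 m2 r ! (j - 1)) (pair_pmf S (pair_pmf P1 P2))"

definition run_out ::
  "('a1 list \<times> 'a2 list) pmf \<Rightarrow> nat pmf \<Rightarrow> nat pmf \<Rightarrow>
   (nat \<Rightarrow> 'a1 list \<Rightarrow> nat \<Rightarrow> nat list \<Rightarrow> nat) \<Rightarrow> (nat \<Rightarrow> 'a2 list \<Rightarrow> nat \<Rightarrow> nat list \<Rightarrow> nat) \<Rightarrow>
   ('a1 list \<Rightarrow> nat \<Rightarrow> nat list \<Rightarrow> 'b1 list) \<Rightarrow> ('a2 list \<Rightarrow> nat \<Rightarrow> nat list \<Rightarrow> 'b2 list) \<Rightarrow>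
   nat \<Rightarrow> ('a1 list \<times> 'a2 list \<times> 'b1 list \<times> 'b2 list) pmf" where
  "run_out S P1 P2 f1 f2 g1 g2 r =
     map_pmf (\<lambda>((a1, a2), m1, m2). let cs = transcript f1 f2 a1 a2 m1 m2 r
        in (a1, a2, g1 a1 m1 cs, g2 a2 m2 cs)) (pair_pmf S (pair_pmf P1 P2))"

lemma l1_dist_pair: "l1_dist (pair_pmf S' Q) (pair_pmf S Q) \<le> l1_dist S' S"
  unfolding pair_pmf_def by (rule l1_dist_bind)

text \<open>Private randomness is a single natural number, so the abort coin has to be packed
  together with the original randomness.\<close>

definition flip_encode :: "nat \<times> bool \<Rightarrow> nat" where
  "flip_encode = (\<lambda>(m, e). prod_encode (m, if e then 1 else 0))"

text \<open>The coin is \<open>True\<close>, meaning that the node goes on, with probability 1 -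
  \<delta>. Each node tosses its own, as there is no common randomness.\<close>

definition with_flip :: "real \<Rightarrow> nat pmf \<Rightarrow> nat pmf" where
  "with_flip \<delta> P = map_pmf flip_encode (pair_pmf P (bernoulli_pmf (1 - \<delta>)))"

text \<open>A code is made robust against a perturbed source. Message \<open>0\<close> announces that the run is aborted,
  \<open>Suc c\<close> carries the original message \<open>c\<close>. The random abort frees a fraction \<open>\<delta>\<close> of
  the rate, and aborting on messages of surprisal above \<open>B\<close> bounds the effect of the perturbation
  on the entropies. A node with rate \<open>0\<close> has no rate to free, but its messages are almost surely
  constant and can be replaced by constants.\<close>

locale interactive_code =
  fixes S :: "('a1 list \<times> 'a2 list) pmf" and P1 P2 :: "nat pmf"
    and f1 :: "nat \<Rightarrow> 'a1 list \<Rightarrow> nat \<Rightarrow> nat list \<Rightarrow> nat"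
    and f2 :: "nat \<Rightarrow> 'a2 list \<Rightarrow> nat \<Rightarrow> nat list \<Rightarrow> nat"
    and r :: nat and H1 H2 B \<delta> :: real
  assumes ent1: "(\<Sum>j\<in>{j\<in>{1..r}. odd j}. entropy_nn (run_msg S P1 P2 f1 f2 r j)) \<le> ennreal H1"
    and ent2: "(\<Sum>j\<in>{j\<in>{1..r}. even j}. entropy_nn (run_msg S P1 P2 f1 f2 r j)) \<le> ennreal H2"
    and nonneg: "0 \<le> H1" "0 \<le> H2"
    and B: "0 < B" and \<delta>: "0 \<le> \<delta>" "\<delta> \<le> 1"
begin

abbreviation law :: "nat \<Rightarrow> nat pmf" where "law \<equiv> run_msg S P1 P2 f1 f2 r"

definition const_msg :: "nat \<Rightarrow> nat" where "const_msg j = (SOME c. law j = return_pmf c)"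

definition silent1 where "silent1 \<longleftrightarrow> H1 = 0"
definition silent2 where "silent2 \<longleftrightarrow> H2 = 0"

text \<open>The nominal code with constants for silent nodes. It agrees with the original almost
  surely under \<open>S\<close>, but a perturbed source may tell them apart, so the entropy
  estimates have to go through this variant.\<close>

definition ideal1 where "ideal1 j a m cs = (if silent1 then const_msg j else f1 j a m cs)"
definition ideal2 where "ideal2 j a m cs = (if silent2 then const_msg j else f2 j a m cs)"

text \<open>Positivity has to be demanded separately: for a message impossible under the nominal law
  the logarithm is a mere default value.\<close>

definition good :: "nat \<Rightarrow> nat \<Rightarrow> bool" where
  "good j c \<longleftrightarrow> 0 < pmf (law j) c \<and> - log 2 (pmf (law j) c) \<le> B"

text \<open>Testing \<open>0 \<notin> set cs\<close> lets an abort by one node stop the other, and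
  guarantees that the decremented transcript is genuine whenever its value matters.\<close>

definition sift :: "nat \<Rightarrow> bool \<Rightarrow> nat \<Rightarrow> nat list \<Rightarrow> nat" where
  "sift j e c cs = (if e \<and> 0 \<notin> set cs \<and> good j c then Suc c else 0)"

definition sifted1 where
  "sifted1 j a m cs = (if silent1 then Suc (const_msg j)
     else sift j (snd (prod_decode m) = 1) (f1 j a (fst (prod_decode m)) (map (\<lambda>c. c - 1) cs)) cs)"
definition sifted2 where
  "sifted2 j a m cs = (if silent2 then Suc (const_msg j)
     else sift j (snd (prod_decode m) = 1) (f2 j a (fst (prod_decode m)) (map (\<lambda>c. c - 1) cs)) cs)"

lemmas node_simps = ideal1_def ideal2_def sifted1_def sifted2_def

text \<open>The index \<open>i\<close> counts from 0, so an even \<open>i\<close> stands for the odd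
  round \<open>Suc i\<close>, which belongs to node 1.\<close>

abbreviation active :: "nat \<Rightarrow> bool" where
  "active i \<equiv> (if even i then \<not> silent1 else \<not> silent2)"

lemma law_const:
  assumes "i < r" "\<not> active i"
  shows "law (Suc i) = return_pmf (const_msg (Suc i))"
proof -
  have "entropy_nn (law (Suc i)) = 0"
  proof (cases "even i")
    case True
    hence "(\<Sum>j\<in>{j\<in>{1..r}. odd j}. entropy_nn (law j)) = 0" using ent1 assms by (simp add: silent1_def)
    thus ?thesis using True assms by simp
  next
    case False
    hence "(\<Sum>j\<in>{j\<in>{1..r}. even j}. entropy_nn (law j)) = 0" using ent2 assms by (simp add: silent2_def)
    thus ?thesis using False assms by simp
  qed
  from entropy_eq_0_imp_return[OF this] show ?thesis
    unfolding const_msg_def by (rule someI_ex)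
qed

text \<open>On the support of the nominal run, a silent node's message lies in the support of a
  point mass and so is the constant.\<close>

lemma transcript_ideal_eq:
  assumes v: "((a1, a2), m1, m2) \<in> set_pmf (pair_pmf S (pair_pmf P1 P2))" and "k \<le> r"
  shows "transcript ideal1 ideal2 a1 a2 m1 m2 k = transcript f1 f2 a1 a2 m1 m2 k"
  using \<open>k \<le> r\<close>
proof (induction k)
  case (Suc k)
  let ?T = "transcript f1 f2 a1 a2 m1 m2"
  have "?T r ! k = const_msg (Suc k)" if "\<not> active k"
  proof -
    have "?T r ! k \<in> set_pmf (law (Suc k))"
      unfolding run_msg_def set_map_pmf using v by (intro image_eqI[where x = "((a1, a2), m1, m2)"]) auto
    thus ?thesis using law_const[of k] that Suc.prems by simp
  qed
  thus ?case
    using Suc nth_transcript[of k r f1 f2 a1 a2 m1 m2] by (auto simp: transcript_Suc node_simps)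
qed simp

lemma law_ideal:
  assumes "i < r"
  shows "run_msg S P1 P2 ideal1 ideal2 r (Suc i) = law (Suc i)"
  unfolding run_msg_def by (intro map_pmf_cong refl) (auto simp: transcript_ideal_eq)

section \<open>Comparison of robust and ideal transcripts\<close>

abbreviation ideal where "ideal a1 a2 m1 m2 \<equiv> transcript ideal1 ideal2 a1 a2 m1 m2"
abbreviation sifted where
  "sifted a1 a2 m1 e1 m2 e2 \<equiv> transcript sifted1 sifted2 a1 a2 (flip_encode (m1, e1)) (flip_encode (m2, e2))"

lemma flip_decode [simp]:
  "fst (prod_decode (flip_encode (m, e))) = m" "snd (prod_decode (flip_encode (m, e))) = Suc 0 \<longleftrightarrow> e"
  "snd (prod_decode (flip_encode (m, e))) = 1 \<longleftrightarrow> e"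
  by (simp_all add: flip_encode_def)

lemma sift_transcript_Suc:
  assumes "sifted a1 a2 m1 e1 m2 e2 k = map Suc t" "ideal a1 a2 m1 m2 k = t"
  shows "sifted a1 a2 m1 e1 m2 e2 (Suc k) = map Suc t @
      [if even k then if silent1 then Suc (const_msg (Suc k))
           else if e1 \<and> good (Suc k) (f1 (Suc k) a1 m1 t) then Suc (f1 (Suc k) a1 m1 t) else 0
       else if silent2 then Suc (const_msg (Suc k))
           else if e2 \<and> good (Suc k) (f2 (Suc k) a2 m2 t) then Suc (f2 (Suc k) a2 m2 t) else 0]"
    and "ideal a1 a2 m1 m2 (Suc k) = t @
      [if even k then if silent1 then const_msg (Suc k) else f1 (Suc k) a1 m1 t
       else if silent2 then const_msg (Suc k) else f2 (Suc k) a2 m2 t]"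
  unfolding transcript_Suc[of sifted1] transcript_Suc[of ideal1] assms
  by (simp_all add: node_simps sift_def comp_def image_iff)

lemma sift_transcript_eq:
  "0 \<notin> set (sifted a1 a2 m1 e1 m2 e2 k) \<Longrightarrow> sifted a1 a2 m1 e1 m2 e2 k = map Suc (ideal a1 a2 m1 m2 k)"
proof (induction k)
  case (Suc k)
  have IH: "sifted a1 a2 m1 e1 m2 e2 k = map Suc (ideal a1 a2 m1 m2 k)"
    using Suc by (simp add: transcript_Suc[of sifted1])
  show ?case
    using Suc.prems unfolding sift_transcript_Suc[OF IH refl]
    by (simp split: if_split_asm)
qed simp

text \<open>An active node answers an earlier 0 by 0, so a nonzero message shows that no abort has
  happened yet. Only the sender's own coin is recorded, as that is the one that yields the factor 1
  - \<delta>.\<close>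

lemma sift_transcript_nth:
  assumes i: "i < r" and act: "active i" and c: "sifted a1 a2 m1 e1 m2 e2 r ! i = Suc c"
  shows "(if even i then e1 else e2) \<and> ideal a1 a2 m1 m2 r ! i = c \<and> good (Suc i) c"
proof -
  have "sifted a1 a2 m1 e1 m2 e2 r ! i = sifted a1 a2 m1 e1 m2 e2 (Suc i) ! i"
    and T: "ideal a1 a2 m1 m2 r ! i = ideal a1 a2 m1 m2 (Suc i) ! i"
    using i by (simp_all add: nth_transcript del: transcript.simps)
  with c have c': "sifted a1 a2 m1 e1 m2 e2 (Suc i) ! i = Suc c" by simp
  have z: "0 \<notin> set (sifted a1 a2 m1 e1 m2 e2 i)"
  proof (rule ccontr)
    assume "\<not> 0 \<notin> set (sifted a1 a2 m1 e1 m2 e2 i)"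
    hence "sifted a1 a2 m1 e1 m2 e2 (Suc i) ! i = 0"
      unfolding transcript_Suc[of sifted1] using act
      by (simp add: nth_append node_simps(3,4) sift_def)
    with c' show False by simp
  qed
  have len: "length (ideal a1 a2 m1 m2 i) = i" by simp
  show ?thesis
    using c' act len unfolding T sift_transcript_Suc[OF sift_transcript_eq[OF z] refl]
    by (simp add: nth_append split: if_split_asm)
qed

lemma sift_transcript_complete:
  assumes "e1" "e2" and good: "\<And>i. i < r \<Longrightarrow> good (Suc i) (ideal a1 a2 m1 m2 r ! i)" and "k \<le> r"
  shows "sifted a1 a2 m1 e1 m2 e2 k = map Suc (ideal a1 a2 m1 m2 k)"
  using \<open>k \<le> r\<close>
proof (induction k)
  case (Suc k)
  have IH: "sifted a1 a2 m1 e1 m2 e2 k = map Suc (ideal a1 a2 m1 m2 k)"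
    using Suc by simp
  have "ideal a1 a2 m1 m2 r ! k = ideal a1 a2 m1 m2 (Suc k) ! k"
    using Suc.prems by (simp add: nth_transcript del: transcript.simps)
  hence g: "good (Suc k) (ideal a1 a2 m1 m2 (Suc k) ! k)"
    using good[of k] Suc.prems by simp
  have len: "length (ideal a1 a2 m1 m2 k) = k" by simp
  show ?case
    using assms(1,2) g len unfolding sift_transcript_Suc[OF IH refl]
    by (simp add: nth_append split: if_split_asm)
qed simp

text \<open>The reference law puts half its mass on abort and half on the shifted nominal law, so a
  message costs at most one bit plus, if the coin allows it, a surprisal of at most
  \<open>B\<close>. Truncation makes that surprisal stable under a change of source.\<close>

lemma sift_entropy_active:
  assumes i: "i < r" "active i"
  shows "entropy_nn (run_msg S' (with_flip \<delta> P1) (with_flip \<delta> P2) sifted1 sifted2 r (Suc i))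
     \<le> 1 + ennreal (1 - \<delta>) * (entropy_nn (law (Suc i)) + ennreal B * ennreal (l1_dist S' S))"
proof -
  define p where "p = law (Suc i)"
  \<comment> \<open>reference law for the Gibbs inequality\<close>
  define Q where "Q = bind_pmf (bernoulli_pmf (1/2)) (\<lambda>b. if b then map_pmf Suc p else return_pmf 0)"
  have Q0: "pmf Q 0 = 1/2"
    unfolding Q_def by (simp add: pmf_bind pmf_map_outside)
  have QS: "pmf Q (Suc c) = pmf p c / 2" for c
    unfolding Q_def by (simp add: pmf_bind pmf_map_inj')
  define \<phi> where "\<phi> c = (if good (Suc i) c then ennreal (- log 2 (pmf p c)) else 0)" for c
  define M where "M = run_msg S' (with_flip \<delta> P1) (with_flip \<delta> P2) sifted1 sifted2 r (Suc i)"
  define W where "W = pair_pmf S' (pair_pmf (pair_pmf P1 (bernoulli_pmf (1 - \<delta>))) (pair_pmf P2 (bernoulli_pmf (1 - \<delta>))))"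
  have M: "M = map_pmf (\<lambda>((a1, a2), (m1, e1), (m2, e2)). sifted a1 a2 m1 e1 m2 e2 r ! i) W"
    unfolding M_def run_msg_def with_flip_def W_def
    by (simp add: pair_map_pmf1 pair_map_pmf2 map_pmf_comp) (auto intro!: map_pmf_cong)
  \<comment> \<open>A perturbed source could produce messages of nominal probability 0, for which
    the reference law would be useless. Sifting turns them into 0.\<close>
  have posQ: "0 < pmf Q y" if y: "y \<in> set_pmf M" for y
  proof (cases y)
    case 0 thus ?thesis using Q0 by simp
  next
    case (Suc c)
    then obtain a1 a2 m1 e1 m2 e2 where "sifted a1 a2 m1 e1 m2 e2 r ! i = Suc c"
      using y unfolding M by auto
    from sift_transcript_nth[OF i this] have "0 < pmf p c" by (simp add: good_def p_def)
    thus ?thesis by (simp add: Suc QS)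
  qed
  have coin: "ennreal (1 - \<delta>) * x + ennreal \<delta> * x = x" for x
    using \<delta> by (simp flip: distrib_right ennreal_plus)
  have "entropy_nn M \<le> (\<integral>\<^sup>+ y. ennreal (- log 2 (pmf Q y)) \<partial>measure_pmf M)"
    by (rule gibbs_inequality) (auto simp: nn_integral_pmf_UNIV pmf_le_1 posQ)
  also have "\<dots> = (\<integral>\<^sup>+ ((a1, a2), (m1, e1), (m2, e2)). ennreal (- log 2 (pmf Q (sifted a1 a2 m1 e1 m2 e2 r ! i))) \<partial>measure_pmf W)"
    unfolding M by (simp add: case_prod_unfold)
  also have "\<dots> \<le> (\<integral>\<^sup>+ ((a1, a2), (m1, e1), (m2, e2)).
      1 + (if (if even i then e1 else e2) then \<phi> (ideal a1 a2 m1 m2 r ! i) else 0) \<partial>measure_pmf W)"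
  proof (rule nn_integral_mono, clarify)
    fix a1 a2 m1 e1 m2 e2
    show "ennreal (- log 2 (pmf Q (sifted a1 a2 m1 e1 m2 e2 r ! i)))
       \<le> 1 + (if (if even i then e1 else e2) then \<phi> (ideal a1 a2 m1 m2 r ! i) else 0)"
    proof (cases "sifted a1 a2 m1 e1 m2 e2 r ! i")
      case 0
      thus ?thesis by (simp add: Q0 log_divide)
    next
      case (Suc c)
      note * = sift_transcript_nth[OF i Suc]
      hence pc: "0 < pmf p c" "- log 2 (pmf p c) \<ge> 0" by (auto simp: good_def p_def pmf_le_1)
      have "- log 2 (pmf p c / 2) = 1 + - log 2 (pmf p c)"
        using pc by (simp add: log_divide)
      hence "ennreal (- log 2 (pmf p c / 2)) = 1 + ennreal (- log 2 (pmf p c))"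
        using pc by (simp only: ennreal_plus ennreal_1 zero_le_one)
      thus ?thesis using * unfolding Suc QS \<phi>_def by simp
    qed
  qed
  \<comment> \<open>The sender's coin is independent of the ideal transcript, so its probability
    factors out. The other coin is averaged away.\<close>
  also have "\<dots> = 1 + ennreal (1 - \<delta>) * (\<integral>\<^sup>+ ((a1, a2), m1, m2). \<phi> (ideal a1 a2 m1 m2 r ! i) \<partial>measure_pmf (pair_pmf S' (pair_pmf P1 P2)))"
    using \<delta>
    by (cases "even i") (simp_all add: W_def nn_integral_pair_pmf' case_prod_unfold nn_integral_add
       nn_integral_cmult nn_integral_multc mult.commute coin)
  also have "(\<integral>\<^sup>+ ((a1, a2), m1, m2). \<phi> (ideal a1 a2 m1 m2 r ! i) \<partial>measure_pmf (pair_pmf S' (pair_pmf P1 P2)))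
     = (\<integral>\<^sup>+ c. \<phi> c \<partial>measure_pmf (run_msg S' P1 P2 ideal1 ideal2 r (Suc i)))"
    by (simp add: run_msg_def case_prod_unfold)
  \<comment> \<open>Back to the nominal law: by \<open>law_ideal\<close>, \<open>p\<close> is the
    law of the same ideal message under \<open>S\<close>, so both laws are images of
    \<open>S'\<close> and \<open>S\<close> under one kernel.\<close>
  also have "\<dots> \<le> (\<integral>\<^sup>+ c. \<phi> c \<partial>measure_pmf p) + ennreal B * ennreal (l1_dist (run_msg S' P1 P2 ideal1 ideal2 r (Suc i)) p)"
    using B by (intro expectation_le_l1) (auto simp: \<phi>_def good_def p_def ennreal_leI)
  also have "\<dots> \<le> entropy_nn p + ennreal B * ennreal (l1_dist S' S)"
  proof (intro add_mono mult_left_mono ennreal_leI)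
    show "(\<integral>\<^sup>+ c. \<phi> c \<partial>measure_pmf p) \<le> entropy_nn p"
      unfolding entropy_nn_def by (intro nn_integral_mono) (auto simp: \<phi>_def)
    have "l1_dist (run_msg S' P1 P2 ideal1 ideal2 r (Suc i)) (run_msg S P1 P2 ideal1 ideal2 r (Suc i)) \<le> l1_dist S' S"
      unfolding run_msg_def by (rule order_trans[OF l1_dist_map l1_dist_pair])
    thus "l1_dist (run_msg S' P1 P2 ideal1 ideal2 r (Suc i)) p \<le> l1_dist S' S"
      by (simp add: p_def law_ideal[OF i(1)])
  qed simp
  finally show ?thesis
    by (simp add: M_def p_def add_left_mono mult_left_mono)
qed

lemma sift_entropy_inactive:
  assumes i: "i < r" "\<not> active i"
  shows "entropy_nn (run_msg S' Q1 Q2 sifted1 sifted2 r (Suc i)) = 0"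
proof -
  have "transcript sifted1 sifted2 a1 a2 m1 m2 r ! i = Suc (const_msg (Suc i))" for a1 a2 m1 m2
    using i by (auto simp: nth_transcript node_simps split: if_splits)
  hence "run_msg S' Q1 Q2 sifted1 sifted2 r (Suc i) = return_pmf (Suc (const_msg (Suc i)))"
    by (simp add: run_msg_def case_prod_unfold)
  thus ?thesis by simp
qed

text \<open>\<open>J\<close> stands for the rounds of one node and \<open>H\<close> for its budget.
  Adding up the single-message bounds gives r (1 + B \<eta>) + (1 - \<delta>) H, and
  \<open>slack\<close> says that this is at most H. For H = 0 all messages are constant.\<close>

lemma sift_entropy_sum:
  assumes J: "J \<subseteq> {1..r}" and act: "\<And>j. j \<in> J \<Longrightarrow> active (j - 1) \<longleftrightarrow> H \<noteq> 0"
    and ent: "(\<Sum>j\<in>J. entropy_nn (law j)) \<le> ennreal H" and H: "0 \<le> H"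
    and slack: "H \<noteq> 0 \<Longrightarrow> real r + real r * B * \<eta> \<le> \<delta> * H"
    and dist: "l1_dist S' S \<le> \<eta>"
  shows "(\<Sum>j\<in>J. entropy_nn (run_msg S' (with_flip \<delta> P1) (with_flip \<delta> P2) sifted1 sifted2 r j)) \<le> ennreal H"
proof (cases "H = 0")
  case True
  have "entropy_nn (run_msg S' (with_flip \<delta> P1) (with_flip \<delta> P2) sifted1 sifted2 r j) = 0" if "j \<in> J" for j
    using sift_entropy_inactive[of "j - 1"] that J act[OF that] True by (cases j) auto
  thus ?thesis by simp
next
  case False
  have \<eta>: "0 \<le> \<eta>" using dist l1_dist_nonneg order_trans by blast
  have card: "card J \<le> r" using card_mono[OF _ J] by simp
  have "(\<Sum>j\<in>J. entropy_nn (run_msg S' (with_flip \<delta> P1) (with_flip \<delta> P2) sifted1 sifted2 r j))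
      \<le> (\<Sum>j\<in>J. (1 + ennreal (B * \<eta>)) + ennreal (1 - \<delta>) * entropy_nn (law j))"
  proof (rule sum_mono)
    fix j assume j: "j \<in> J"
    then obtain i where i: "j = Suc i" "i < r" "active i"
      using J act[OF j] False by (cases j) auto
    have "ennreal (1 - \<delta>) * (ennreal B * ennreal (l1_dist S' S)) \<le> 1 * (ennreal B * ennreal \<eta>)"
      using dist \<delta> by (intro mult_mono ennreal_leI) (auto simp: ennreal_le_1)
    also have "\<dots> = ennreal (B * \<eta>)" using B \<eta> by (simp add: ennreal_mult)
    finally have "1 + (ennreal (1 - \<delta>) * entropy_nn (law j) + ennreal (1 - \<delta>) * (ennreal B * ennreal (l1_dist S' S)))
        \<le> 1 + (ennreal (1 - \<delta>) * entropy_nn (law j) + ennreal (B * \<eta>))"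
      by (intro add_left_mono)
    from order_trans[OF sift_entropy_active[OF i(2,3), of S', folded i(1), unfolded distrib_left] this]
    show "entropy_nn (run_msg S' (with_flip \<delta> P1) (with_flip \<delta> P2) sifted1 sifted2 r j)
       \<le> (1 + ennreal (B * \<eta>)) + ennreal (1 - \<delta>) * entropy_nn (law j)"
      by (simp add: ac_simps)
  qed
  also have "\<dots> = of_nat (card J) * (1 + ennreal (B * \<eta>)) + ennreal (1 - \<delta>) * (\<Sum>j\<in>J. entropy_nn (law j))"
    by (simp add: sum.distrib sum_distrib_left)
  also have "\<dots> \<le> ennreal (real r * (1 + B * \<eta>)) + ennreal (1 - \<delta>) * ennreal H"
  proof (intro add_mono mult_left_mono ent)
    have "of_nat (card J) * (1 + ennreal (B * \<eta>)) = ennreal (real (card J) * (1 + B * \<eta>))"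
      using B \<eta> by (simp add: ennreal_mult ennreal_of_nat_eq_real_of_nat)
    also have "\<dots> \<le> ennreal (real r * (1 + B * \<eta>))"
      using card B \<eta> by (intro ennreal_leI mult_right_mono) auto
    finally show "of_nat (card J) * (1 + ennreal (B * \<eta>)) \<le> ennreal (real r * (1 + B * \<eta>))" .
  qed simp
  also have "\<dots> = ennreal (real r * (1 + B * \<eta>) + (1 - \<delta>) * H)"
    using \<delta> H B \<eta> by (simp add: ennreal_mult)
  also have "\<dots> \<le> ennreal H"
    using slack[OF False] by (intro ennreal_leI) (simp add: algebra_simps)
  finally show ?thesis .
qed

section \<open>Abort probability and output law of the robust code\<close>

lemma prob_not_good:
  "emeasure (law j) {c. \<not> good j c} * ennreal B \<le> entropy_nn (law j)"
proof -
  have "emeasure (law j) {c. \<not> good j c} * ennreal B = (\<integral>\<^sup>+ c. ennreal B * indicator {c. \<not> good j c} c \<partial>law j)"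
    by (simp add: nn_integral_cmult mult.commute)
  \<comment> \<open>Markov's inequality: on the support, a message that is not good has surprisal
    above \<open>B\<close>.\<close>
  also have "\<dots> \<le> entropy_nn (law j)"
    unfolding entropy_nn_def
    by (intro nn_integral_mono_AE)
      (auto simp: AE_measure_pmf_iff good_def indicator_def pmf_positive intro!: ennreal_leI)
  finally show ?thesis .
qed

lemma prob_some_not_good:
  "measure_pmf.prob (pair_pmf S (pair_pmf P1 P2))
     {((a1, a2), m1, m2). \<exists>i<r. \<not> good (Suc i) (transcript f1 f2 a1 a2 m1 m2 r ! i)} \<le> (H1 + H2) / B"
  (is "measure_pmf.prob ?V ?E \<le> _")
proof -
  let ?A = "\<lambda>i. (\<lambda>((a1, a2), m1, m2). transcript f1 f2 a1 a2 m1 m2 r ! i) -` {c. \<not> good (Suc i) c}"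
  have law: "law (Suc i) = map_pmf (\<lambda>((a1, a2), m1, m2). transcript f1 f2 a1 a2 m1 m2 r ! i) ?V" for i
    by (simp add: run_msg_def)
  have "emeasure ?V ?E * ennreal B \<le> emeasure ?V (\<Union>i<r. ?A i) * ennreal B"
    by (intro mult_right_mono emeasure_mono) auto
  also have "\<dots> \<le> (\<Sum>i<r. emeasure ?V (?A i)) * ennreal B"
    by (intro mult_right_mono emeasure_subadditive_finite) auto
  also have "\<dots> = (\<Sum>i<r. emeasure (law (Suc i)) {c. \<not> good (Suc i) c} * ennreal B)"
    by (simp add: law sum_distrib_right)
  also have "\<dots> \<le> (\<Sum>i<r. entropy_nn (law (Suc i)))"
    by (intro sum_mono prob_not_good)
  also have "\<dots> = (\<Sum>j\<in>{1..r}. entropy_nn (law j))"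
    by (rule sum.reindex_bij_witness[of _ "\<lambda>j. j - 1" Suc]) auto
  also have "{1..r} = {j\<in>{1..r}. odd j} \<union> {j\<in>{1..r}. even j}" by auto
  also have "(\<Sum>j\<in>\<dots>. entropy_nn (law j)) =
      (\<Sum>j\<in>{j\<in>{1..r}. odd j}. entropy_nn (law j)) + (\<Sum>j\<in>{j\<in>{1..r}. even j}. entropy_nn (law j))"
    by (rule sum.union_disjoint) auto
  also have "\<dots> \<le> ennreal H1 + ennreal H2" by (intro add_mono ent1 ent2)
  finally have "ennreal (measure_pmf.prob ?V ?E * B) \<le> ennreal (H1 + H2)"
    using nonneg B by (simp add: measure_pmf.emeasure_eq_measure ennreal_mult)
  hence "measure_pmf.prob ?V ?E * B \<le> H1 + H2"
    by (subst (asm) ennreal_le_iff) (use nonneg in simp_all)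
  thus ?thesis using B by (simp add: field_simps)
qed

text \<open>Both runs are coupled on one space \<open>W\<close>. They differ only if one of the two
  coins says abort, with probability \<delta> each, or some message is not good. The coupling bound
  doubles the sum.\<close>

lemma sift_out_dist:
  "l1_dist (run_out S (with_flip \<delta> P1) (with_flip \<delta> P2) sifted1 sifted2
       (\<lambda>a m cs. g1 a (fst (prod_decode m)) (map (\<lambda>c. c - 1) cs))
       (\<lambda>a m cs. g2 a (fst (prod_decode m)) (map (\<lambda>c. c - 1) cs)) r)
     (run_out S P1 P2 f1 f2 g1 g2 r) \<le> 4 * \<delta> + 2 * ((H1 + H2) / B)"
  (is "l1_dist ?X ?Y \<le> _")
proof -
  define C where "C = bernoulli_pmf (1 - \<delta>)"
  define W where "W = pair_pmf S (pair_pmf (pair_pmf P1 C) (pair_pmf P2 C))"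
  let ?\<pi> = "\<lambda>(a, (m1, e1::bool), (m2, e2::bool)). (a, m1, m2)"
  have V: "map_pmf ?\<pi> W = pair_pmf S (pair_pmf P1 P2)"
  proof -
    have "pair_pmf S (pair_pmf P1 P2) = pair_pmf S (pair_pmf (map_pmf fst (pair_pmf P1 C)) (map_pmf fst (pair_pmf P2 C)))"
      by (simp add: map_fst_pair_pmf)
    also have "\<dots> = map_pmf ?\<pi> W"
      unfolding W_def
      by (simp only: pair_map_pmf1 pair_map_pmf2 map_pmf_comp) (auto intro!: map_pmf_cong)
    finally show ?thesis ..
  qed
  let ?F = "\<lambda>((a1, a2), (m1, e1), (m2, e2)). let cs = map (\<lambda>c. c - 1) (sifted a1 a2 m1 e1 m2 e2 r)
     in (a1, a2, g1 a1 m1 cs, g2 a2 m2 cs)"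
  let ?G = "\<lambda>((a1, a2), (m1, e1::bool), (m2, e2::bool)). let cs = transcript f1 f2 a1 a2 m1 m2 r
     in (a1, a2, g1 a1 m1 cs, g2 a2 m2 cs)"
  have X: "?X = map_pmf ?F W"
    unfolding run_out_def with_flip_def W_def C_def
    by (simp add: pair_map_pmf1 pair_map_pmf2 map_pmf_comp) (auto simp: Let_def intro!: map_pmf_cong)
  have Y: "?Y = map_pmf ?G W"
    unfolding run_out_def V[symmetric] by (simp add: map_pmf_comp case_prod_unfold)
  let ?D = "{((a1, a2), m1, m2). \<exists>i<r. \<not> good (Suc i) (transcript f1 f2 a1 a2 m1 m2 r ! i)}"
  define E1 where "E1 = (\<lambda>w. snd (fst (snd w))) -` {False} \<inter> (UNIV :: (('a1 list \<times> 'a2 list) \<times> (nat \<times> bool) \<times> nat \<times> bool) set)"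
  define E2 where "E2 = (\<lambda>w. snd (snd (snd w))) -` {False} \<inter> (UNIV :: (('a1 list \<times> 'a2 list) \<times> (nat \<times> bool) \<times> nat \<times> bool) set)"
  define E3 where "E3 = ?\<pi> -` ?D"
  have "l1_dist ?X ?Y \<le> 2 * measure_pmf.prob W (E1 \<union> (E2 \<union> E3))"
    unfolding X Y
  proof (rule l1_dist_map_neq)
    fix w assume "w \<in> set_pmf W" "w \<notin> E1 \<union> (E2 \<union> E3)"
    moreover obtain a1 a2 m1 e1 m2 e2 where w_eq: "w = ((a1, a2), (m1, e1), (m2, e2))"
      by (metis surj_pair)
    ultimately have w: "((a1, a2), (m1, e1), (m2, e2)) \<in> set_pmf W"
      and n: "((a1, a2), (m1, e1), (m2, e2)) \<notin> E1 \<union> (E2 \<union> E3)" by auto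
    have v: "((a1, a2), m1, m2) \<in> set_pmf (pair_pmf S (pair_pmf P1 P2))"
      using w by (auto simp: W_def)
    have "sifted a1 a2 m1 e1 m2 e2 r = map Suc (ideal a1 a2 m1 m2 r)"
      using n transcript_ideal_eq[OF v, of r]
      by (intro sift_transcript_complete) (auto simp: E1_def E2_def E3_def)
    thus "?F w = ?G w"
      using transcript_ideal_eq[OF v, of r] by (simp add: comp_def w_eq)
  qed
  moreover have "measure_pmf.prob W (E1 \<union> (E2 \<union> E3)) \<le> measure_pmf.prob W E1 + (measure_pmf.prob W E2 + measure_pmf.prob W E3)"
    by (intro order_trans[OF measure_Un_le] add_mono) auto
  moreover have "measure_pmf.prob W E1 = \<delta>"
  proof -
    have "measure_pmf.prob W E1 = measure_pmf.prob (map_pmf snd (map_pmf fst (map_pmf snd W))) {False}"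
      by (simp add: E1_def map_pmf_comp)
    thus ?thesis using \<delta> by (simp add: W_def map_fst_pair_pmf map_snd_pair_pmf C_def measure_pmf_single)
  qed
  moreover have "measure_pmf.prob W E2 = \<delta>"
  proof -
    have "measure_pmf.prob W E2 = measure_pmf.prob (map_pmf snd (map_pmf snd (map_pmf snd W))) {False}"
      by (simp add: E2_def map_pmf_comp)
    thus ?thesis using \<delta> by (simp add: W_def map_fst_pair_pmf map_snd_pair_pmf C_def measure_pmf_single)
  qed
  moreover have "measure_pmf.prob W E3 \<le> (H1 + H2) / B"
    using prob_some_not_good unfolding V[symmetric] E3_def by simp
  ultimately show ?thesis by linarith
qed

end

section \<open>Concatenation of codes\<close>

text \<open>Round \<open>j\<close> of the merged code carries message \<open>j\<close> of the first code and message \<open>j - s\<close> of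
  the second one, where \<open>s\<close> is \<open>r1\<close> rounded down to an even number, so that parities agree. For
  odd \<open>r1\<close>, round \<open>r1\<close> carries both the last message of the first code and the first message of
  the second one. A missing message is \<open>0\<close>.\<close>

definition merge_msg where
  "merge_msg r1 r2 f g k j x m cs =
    (let s = 2 * (r1 div 2); ds = map prod_decode cs; t = take r1 (map fst ds);
         c = (if j \<le> r1 then f j x (fst (prod_decode m)) t else 0);
         u = (if j = r1 then t @ [c] else t);
         c' = (if s < j \<and> j \<le> s + r2
           then k (j - s) (zip x (g x (fst (prod_decode m)) u)) (snd (prod_decode m)) (drop s (map snd ds)) else 0)
     in prod_encode (c, c'))"

text \<open>For odd \<open>r1\<close> the messages of the second code end one round before the last,
  hence \<open>take r2\<close> to drop the padding.\<close>

definition merge_out where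
  "merge_out r1 r2 g l x m cs =
    (let s = 2 * (r1 div 2); ds = map prod_decode cs; t = take r1 (map fst ds)
     in l (zip x (g x (fst (prod_decode m)) t)) (snd (prod_decode m)) (take r2 (drop s (map snd ds))))"

text \<open>Closed form of the first \<open>j\<close> merged rounds in terms of two complete
  transcripts. The index \<open>i\<close> counts from 0.\<close>

definition merged_list :: "nat \<Rightarrow> nat \<Rightarrow> nat list \<Rightarrow> nat list \<Rightarrow> nat \<Rightarrow> nat list" where
  "merged_list r1 r2 t t' j = map (\<lambda>i. prod_encode (if i < r1 then t ! i else 0,
     if 2 * (r1 div 2) \<le> i \<and> i < 2 * (r1 div 2) + r2 then t' ! (i - 2 * (r1 div 2)) else 0)) [0..<j]"

lemma merged_list_fst:
  assumes "length t = r1"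
  shows "take r1 (map fst (map prod_decode (merged_list r1 r2 t t' j))) = take j t"
  by (rule nth_equalityI) (use assms in \<open>auto simp: merged_list_def\<close>)

lemma merged_list_snd:
  assumes "length t' = r2"
  shows "take r2 (drop (2 * (r1 div 2)) (map snd (map prod_decode (merged_list r1 r2 t t' j)))) = take (j - 2 * (r1 div 2)) t'"
  by (rule nth_equalityI) (use assms in \<open>auto simp: merged_list_def\<close>)

text \<open>One induction step, stated for an unspecified node so that it serves both
  parities.\<close>

lemma merge_msg_eq:
  assumes len: "length t = r1" "length t' = r2"
    and c: "j < r1 \<Longrightarrow> f (Suc j) x m (take j t) = t ! j"
    and c': "2 * (r1 div 2) \<le> j \<Longrightarrow> j < 2 * (r1 div 2) + r2 \<Longrightarrow>
       k (Suc (j - 2 * (r1 div 2))) (zip x (g x m t)) m' (take (j - 2 * (r1 div 2)) t') = t' ! (j - 2 * (r1 div 2))"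
  shows "merged_list r1 r2 t t' j @ [merge_msg r1 r2 f g k (Suc j) x (prod_encode (m, m')) (merged_list r1 r2 t t' j)]
    = merged_list r1 r2 t t' (Suc j)"
proof -
  define s where "s = 2 * (r1 div 2)"
  have s: "s \<le> r1" "r1 \<le> Suc s" by (auto simp: s_def)
  have dr: "drop s (map snd (map prod_decode (merged_list r1 r2 t t' j))) = take (j - s) t'" if "j < s + r2"
    using merged_list_snd[OF len(2), of r1 t j] that by (simp add: merged_list_def s_def)
  \<comment> \<open>When the second code starts, the sender knows the whole first transcript: for
    odd \<open>r1\<close> its last entry is the message that the sender is about to send
    itself.\<close>
  have u: "(if Suc j = r1 then take j t @ [t ! j] else take j t) = t" if "s \<le> j"
    using that s len by (auto simp: take_Suc_conv_app_nth[symmetric])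
  have "merge_msg r1 r2 f g k (Suc j) x (prod_encode (m, m')) (merged_list r1 r2 t t' j)
    = prod_encode (if j < r1 then t ! j else 0, if s \<le> j \<and> j < s + r2 then t' ! (j - s) else 0)"
  proof (cases "s \<le> j \<and> j < s + r2")
    case True
    hence "Suc j - s = Suc (j - s)" by (simp add: Suc_diff_le)
    thus ?thesis
      using True c c' u dr
      unfolding merge_msg_def Let_def merged_list_fst[OF len(1)] s_def[symmetric] by (auto split: if_splits)
  next
    case False
    thus ?thesis
      using c unfolding merge_msg_def Let_def merged_list_fst[OF len(1)] s_def[symmetric] by auto
  qed
  thus ?thesis by (simp add: merged_list_def s_def)
qed

text \<open>As the shift 2 * (r1 div 2) is even, each merged round has the same speaker in both
  codes.\<close>

lemma transcript_merge:
  assumes t: "t = transcript f1 f2 x1 x2 m1 m2 r1"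
    and t': "t' = transcript k1 k2 (zip x1 (g1 x1 m1 t)) (zip x2 (g2 x2 m2 t)) m1' m2' r2"
  shows "transcript (merge_msg r1 r2 f1 g1 k1) (merge_msg r1 r2 f2 g2 k2) x1 x2
     (prod_encode (m1, m1')) (prod_encode (m2, m2')) j = merged_list r1 r2 t t' j"
proof (induction j)
  case 0
  show ?case by (simp add: merged_list_def)
next
  case (Suc j)
  have len: "length t = r1" "length t' = r2" by (simp_all add: t t')
  show ?case
  proof (cases "even j")
    case True
    show ?thesis
      unfolding transcript_Suc Suc
      by (simp only: True if_True, rule merge_msg_eq[OF len])
        (use True in \<open>auto simp: t t' take_transcript nth_transcript\<close>)
  next
    case False
    show ?thesis
      unfolding transcript_Suc Suc
      by (simp only: False if_False, rule merge_msg_eq[OF len])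
        (use False in \<open>auto simp: t t' take_transcript nth_transcript\<close>)
  qed
qed

text \<open>Simulated outputs may have a wrong length, in which case \<open>zip\<close> truncates.
  Only the distance to the nominal law matters, so this does no harm.\<close>

definition chained_source where
  "chained_source out = map_pmf (\<lambda>(x1, x2, z1, z2). (zip x1 z1, zip x2 z2)) out"

text \<open>Randomness sorted by node is sorted by code instead, which exhibits the second code's
  randomness as independent of the whole first run.\<close>

lemma pair_pmf_regroup:
  "map_pmf (\<lambda>(x, (m1, m1'), (m2, m2')). ((x, m1, m2), m1', m2'))
     (pair_pmf A (pair_pmf (pair_pmf P1 Q1) (pair_pmf P2 Q2)))
   = pair_pmf (pair_pmf A (pair_pmf P1 P2)) (pair_pmf Q1 Q2)"
  unfolding pair_pmf_def map_pmf_def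
  by (simp add: bind_assoc_pmf bind_return_pmf, subst bind_commute_pmf[of Q1 P2], rule refl)

context
  fixes S :: "('x1 list \<times> 'x2 list) pmf" and P1 P2 Q1 Q2 :: "nat pmf"
    and f1 :: "nat \<Rightarrow> 'x1 list \<Rightarrow> nat \<Rightarrow> nat list \<Rightarrow> nat" and f2 :: "nat \<Rightarrow> 'x2 list \<Rightarrow> nat \<Rightarrow> nat list \<Rightarrow> nat"
    and k1 :: "nat \<Rightarrow> ('x1 \<times> 'z1) list \<Rightarrow> nat \<Rightarrow> nat list \<Rightarrow> nat"
    and k2 :: "nat \<Rightarrow> ('x2 \<times> 'z2) list \<Rightarrow> nat \<Rightarrow> nat list \<Rightarrow> nat"
    and r1 r2 :: nat
    and g1 :: "'x1 list \<Rightarrow> nat \<Rightarrow> nat list \<Rightarrow> 'z1 list" and g2 :: "'x2 list \<Rightarrow> nat \<Rightarrow> nat list \<Rightarrow> 'z2 list"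
    and l1 :: "('x1 \<times> 'z1) list \<Rightarrow> nat \<Rightarrow> nat list \<Rightarrow> 'y1 list" and l2 :: "('x2 \<times> 'z2) list \<Rightarrow> nat \<Rightarrow> nat list \<Rightarrow> 'y2 list"
begin

private abbreviation "F1 \<equiv> merge_msg r1 r2 f1 g1 k1"
private abbreviation "F2 \<equiv> merge_msg r1 r2 f2 g2 k2"
private abbreviation "M1 \<equiv> map_pmf prod_encode (pair_pmf P1 Q1)"
private abbreviation "M2 \<equiv> map_pmf prod_encode (pair_pmf P2 Q2)"
private abbreviation "V \<equiv> pair_pmf S (pair_pmf P1 P2)"
private abbreviation "tr1 \<equiv> \<lambda>((x1, x2), m1, m2). transcript f1 f2 x1 x2 m1 m2 r1"
private abbreviation "src2 \<equiv> \<lambda>((x1, x2), m1, m2).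
  (zip x1 (g1 x1 m1 (tr1 ((x1, x2), m1, m2))), zip x2 (g2 x2 m2 (tr1 ((x1, x2), m1, m2))))"
private abbreviation "tr2 \<equiv> \<lambda>((a1, a2), m1, m2). transcript k1 k2 a1 a2 m1 m2 r2"
private abbreviation "out1 \<equiv> run_out S P1 P2 f1 f2 g1 g2 r1"

text \<open>The function \<open>h\<close> is left open so that messages and outputs are covered at
  once.\<close>

lemma merged_space:
  "map_pmf (\<lambda>((x1, x2), m1, m2). h x1 x2 m1 m2 (transcript F1 F2 x1 x2 m1 m2 j)) (pair_pmf S (pair_pmf M1 M2)) =
   map_pmf (\<lambda>(((x1, x2), m1, m2), m1', m2'). h x1 x2 (prod_encode (m1, m1')) (prod_encode (m2, m2'))
      (merged_list r1 r2 (tr1 ((x1, x2), m1, m2)) (tr2 (src2 ((x1, x2), m1, m2), m1', m2')) j))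
     (pair_pmf V (pair_pmf Q1 Q2))"
  unfolding pair_pmf_regroup[symmetric]
  by (simp add: pair_map_pmf1 pair_map_pmf2 map_pmf_comp)
    (auto simp: transcript_merge[OF refl refl] intro!: map_pmf_cong)

lemma chained_source_eq: "chained_source out1 = map_pmf src2 V"
  by (simp add: chained_source_def run_out_def map_pmf_comp case_prod_unfold Let_def)

text \<open>Subadditivity, where the two marginals are the message laws of the codes run separately,
  the second on the source produced by the first.\<close>

lemma merged_entropy:
  assumes i: "i < r1 + r2"
  defines "s \<equiv> 2 * (r1 div 2)"
  shows "entropy_nn (run_msg S M1 M2 F1 F2 (r1 + r2) (Suc i)) \<le>
    (if i < r1 then entropy_nn (run_msg S P1 P2 f1 f2 r1 (Suc i)) else 0) +
    (if s \<le> i \<and> i < s + r2 then entropy_nn (run_msg (chained_source out1) Q1 Q2 k1 k2 r2 (Suc (i - s))) else 0)"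
proof -
  define W where "W = pair_pmf V (pair_pmf Q1 Q2)"
  define c where "c w = (if i < r1 then tr1 (fst w) ! i else 0)" for w :: "(('x1 list \<times> 'x2 list) \<times> nat \<times> nat) \<times> nat \<times> nat"
  define c' where "c' w = (if s \<le> i \<and> i < s + r2 then tr2 (src2 (fst w), snd w) ! (i - s) else 0)"
    for w :: "(('x1 list \<times> 'x2 list) \<times> nat \<times> nat) \<times> nat \<times> nat"
  have "run_msg S M1 M2 F1 F2 (r1 + r2) (Suc i) = map_pmf (\<lambda>w. prod_encode (c w, c' w)) W"
    unfolding run_msg_def merged_space[of "\<lambda>_ _ _ _ t. t ! (Suc i - 1)"] W_def c_def c'_def s_def
    using i by (intro map_pmf_cong refl) (auto simp: merged_list_def)
  hence "entropy_nn (run_msg S M1 M2 F1 F2 (r1 + r2) (Suc i)) \<le> entropy_nn (map_pmf c W) + entropy_nn (map_pmf c' W)"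
    using entropy_pair_le by simp
  also have "entropy_nn (map_pmf c W) = (if i < r1 then entropy_nn (run_msg S P1 P2 f1 f2 r1 (Suc i)) else 0)"
  proof -
    have "run_msg S P1 P2 f1 f2 r1 (Suc i) = map_pmf (\<lambda>v. tr1 v ! i) (map_pmf fst W)"
      by (simp add: run_msg_def W_def map_fst_pair_pmf case_prod_unfold)
    thus ?thesis by (simp add: c_def[abs_def] map_pmf_comp)
  qed
  also have "entropy_nn (map_pmf c' W) = (if s \<le> i \<and> i < s + r2
      then entropy_nn (run_msg (chained_source out1) Q1 Q2 k1 k2 r2 (Suc (i - s))) else 0)"
  proof -
    have "run_msg (chained_source out1) Q1 Q2 k1 k2 r2 (Suc (i - s)) = map_pmf (\<lambda>w. tr2 (src2 (fst w), snd w) ! (i - s)) W"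
      unfolding run_msg_def chained_source_eq W_def pair_map_pmf1 map_pmf_comp
      by (intro map_pmf_cong refl) (auto simp: case_prod_unfold)
    moreover have "c' = (\<lambda>_. 0)" if "\<not> (s \<le> i \<and> i < s + r2)"
      using that by (intro ext) (simp only: c'_def if_False)
    ultimately show ?thesis
      by (cases "s \<le> i \<and> i < s + r2") (simp_all add: c'_def[abs_def] if_not_P)
  qed
  finally show ?thesis .
qed

text \<open>The flag \<open>b\<close> selects the node. Reindexing by an even shift keeps it
  unchanged.\<close>

lemma merged_entropy_sum:
  "(\<Sum>j\<in>{j\<in>{1..r1+r2}. odd j = b}. entropy_nn (run_msg S M1 M2 F1 F2 (r1 + r2) j)) \<le>
     (\<Sum>j\<in>{j\<in>{1..r1}. odd j = b}. entropy_nn (run_msg S P1 P2 f1 f2 r1 j)) +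
     (\<Sum>j\<in>{j\<in>{1..r2}. odd j = b}. entropy_nn (run_msg (chained_source out1) Q1 Q2 k1 k2 r2 j))"
proof -
  define s where "s = 2 * (r1 div 2)"
  have s: "even s" "s \<le> r1" by (auto simp: s_def)
  let ?J = "{j\<in>{1..r1+r2}. odd j = b}"
  let ?e = "\<lambda>j. entropy_nn (run_msg S P1 P2 f1 f2 r1 j)"
  let ?e' = "\<lambda>j. entropy_nn (run_msg (chained_source out1) Q1 Q2 k1 k2 r2 j)"
  have "(\<Sum>j\<in>?J. entropy_nn (run_msg S M1 M2 F1 F2 (r1 + r2) j)) \<le>
     (\<Sum>j\<in>?J. (if j \<le> r1 then ?e j else 0) + (if s < j \<and> j \<le> s + r2 then ?e' (j - s) else 0))"
  proof (rule sum_mono)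
    fix j assume "j \<in> ?J"
    then obtain i where i: "j = Suc i" "i < r1 + r2" by (cases j) auto
    have "(if j \<le> r1 then ?e j else 0) + (if s < j \<and> j \<le> s + r2 then ?e' (j - s) else 0) =
      (if i < r1 then ?e (Suc i) else 0) + (if s \<le> i \<and> i < s + r2 then ?e' (Suc (i - s)) else 0)"
      by (simp add: i Suc_diff_le less_Suc_eq_le Suc_le_eq)
    thus "entropy_nn (run_msg S M1 M2 F1 F2 (r1 + r2) j) \<le>
      (if j \<le> r1 then ?e j else 0) + (if s < j \<and> j \<le> s + r2 then ?e' (j - s) else 0)"
      using merged_entropy[OF i(2)] by (simp only: i(1) s_def)
  qed
  also have "\<dots> = (\<Sum>j\<in>{j\<in>?J. j \<le> r1}. ?e j) + (\<Sum>j\<in>{j\<in>?J. s < j \<and> j \<le> s + r2}. ?e' (j - s))"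
    unfolding sum.distrib by (intro arg_cong2[where f = "(+)"] sum.inter_filter[symmetric]) auto
  also have "{j\<in>?J. j \<le> r1} = {j\<in>{1..r1}. odd j = b}" by auto
  also have "(\<Sum>j\<in>{j\<in>?J. s < j \<and> j \<le> s + r2}. ?e' (j - s)) = (\<Sum>j\<in>{j\<in>{1..r2}. odd j = b}. ?e' j)"
    by (rule sum.reindex_bij_witness[of _ "\<lambda>j. j + s" "\<lambda>j. j - s"]) (use s in auto)
  finally show ?thesis .
qed

text \<open>Seen as a Markov kernel on the first code's output, the second code cannot increase the
  distance to the nominal law.\<close>

definition chained_kernel where
  "chained_kernel = (\<lambda>(x1, x2, z1, z2). map_pmf (\<lambda>(m1, m2).
     let a1 = zip x1 z1; a2 = zip x2 z2; cs = transcript k1 k2 a1 a2 m1 m2 r2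
     in (x1, x2, l1 a1 m1 cs, l2 a2 m2 cs)) (pair_pmf Q1 Q2))"

lemma merged_out:
  "run_out S M1 M2 F1 F2 (merge_out r1 r2 g1 l1) (merge_out r1 r2 g2 l2) (r1 + r2) = bind_pmf out1 chained_kernel"
proof -
  have fst_eq: "take r1 (map fst (map prod_decode (merged_list r1 r2 t t' (r1 + r2)))) = t" if "length t = r1" for t t'
    using merged_list_fst[OF that] that by simp
  have snd_eq: "take r2 (drop (2 * (r1 div 2)) (map snd (map prod_decode (merged_list r1 r2 t t' (r1 + r2))))) = t'"
    if "length t' = r2" for t t'
  proof -
    have "r2 \<le> r1 + r2 - 2 * (r1 div 2)" by simp
    thus ?thesis using merged_list_snd[OF that, of r1 t "r1 + r2"] that by simp
  qed
  have "run_out S M1 M2 F1 F2 (merge_out r1 r2 g1 l1) (merge_out r1 r2 g2 l2) (r1 + r2)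
    = map_pmf (\<lambda>(((x1, x2), m1, m2), m1', m2').
        let t = transcript f1 f2 x1 x2 m1 m2 r1; a1 = zip x1 (g1 x1 m1 t); a2 = zip x2 (g2 x2 m2 t);
          cs = transcript k1 k2 a1 a2 m1' m2' r2 in (x1, x2, l1 a1 m1' cs, l2 a2 m2' cs)) (pair_pmf V (pair_pmf Q1 Q2))"
    unfolding run_out_def Let_def
      merged_space[of "\<lambda>x1 x2 m1 m2 t. (x1, x2, merge_out r1 r2 g1 l1 x1 m1 t, merge_out r1 r2 g2 l2 x2 m2 t)"]
    by (intro map_pmf_cong refl)
      (auto simp: merge_out_def Let_def fst_eq snd_eq simp del: map_map)
  also have "\<dots> = bind_pmf out1 chained_kernel"
    unfolding run_out_def chained_kernel_def bind_map_pmf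
    by (simp add: pair_pmf_def map_pmf_def bind_assoc_pmf bind_return_pmf case_prod_unfold Let_def)
  finally show ?thesis .
qed

end

section \<open>Admissibility\<close>

lemma iid_map: "iid n (map_pmf f p) = map_pmf (map f) (iid n p)"
  by (induction n) (simp_all add: bind_map_pmf map_bind_pmf map_pmf_comp)

text \<open>Built from the full block, so that the sources of all three problems become images of
  \<open>iid n q\<close> and can be compared.\<close>

definition source :: "('a1 \<times> 'a2 \<times> 'b1 \<times> 'b2) pmf \<Rightarrow> nat \<Rightarrow> ('a1 list \<times> 'a2 list) pmf" where
  "source q n = map_pmf (\<lambda>as. (map fst as, map (fst \<circ> snd) as)) (iid n q)"

lemma source_eq: "source q n =
   map_pmf (\<lambda>as. (map fst as, map snd as)) (iid n (map_pmf (\<lambda>(a1, a2, b1, b2). (a1, a2)) q))"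
  by (simp add: source_def iid_map map_pmf_comp comp_def case_prod_unfold)

lemma msg_law_eq: "msg_law q n P1 P2 f1 f2 r j = run_msg (source q n) P1 P2 f1 f2 r j"
  unfolding msg_law_def run_msg_def joint_exp_def source_eq pair_map_pmf1 map_pmf_comp
  by (intro map_pmf_cong refl) auto

lemma out_law_eq: "out_law q n P1 P2 f1 f2 g1 g2 r = run_out (source q n) P1 P2 f1 f2 g1 g2 r"
  unfolding out_law_def run_out_def joint_exp_def source_eq pair_map_pmf1 map_pmf_comp
  by (intro map_pmf_cong refl) (auto simp: Let_def)

text \<open>Entropies are nonnegative, so any code of positive blocklength, here
  \<open>Suc n0\<close>, shows the sign of the rates. Without it, \<open>ennreal\<close> would cut
  off negative rates.\<close>

lemma admissible_nonneg:
  assumes "admissible q r R R'"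
  shows "0 \<le> R" "0 \<le> R'"
proof -
  have "(1::real) > 0" by simp
  with assms obtain n0 where "\<forall>n\<ge>n0. \<exists>P1 P2 f1 f2 g1 g2.
        (\<Sum>j\<in>{j\<in>{1..r}. odd j}. entropy_pmf (msg_law q n P1 P2 f1 f2 r j)) \<le> ereal (real n * R) \<and>
        (\<Sum>j\<in>{j\<in>{1..r}. even j}. entropy_pmf (msg_law q n P1 P2 f1 f2 r j)) \<le> ereal (real n * R') \<and>
        l1_dist (out_law q n P1 P2 f1 f2 g1 g2 r) (map_pmf unzip4 (iid n q)) \<le> 1"
    unfolding admissible_def by blast
  from this[rule_format, of "Suc n0"] obtain P1 P2 f1 f2 where *:
     "(\<Sum>j\<in>{j\<in>{1..r}. odd j}. entropy_pmf (msg_law q (Suc n0) P1 P2 f1 f2 r j)) \<le> ereal (real (Suc n0) * R)"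
     "(\<Sum>j\<in>{j\<in>{1..r}. even j}. entropy_pmf (msg_law q (Suc n0) P1 P2 f1 f2 r j)) \<le> ereal (real (Suc n0) * R')"
    by auto
  have pos: "0 \<le> (\<Sum>j\<in>J. entropy_pmf (p j))" for J and p :: "nat \<Rightarrow> nat pmf"
    by (intro sum_nonneg) (simp add: entropy_pmf_eq)
  have "0 \<le> ereal (real (Suc n0) * R)" "0 \<le> ereal (real (Suc n0) * R')"
    using order_trans[OF pos *(1)] order_trans[OF pos *(2)] .
  thus "0 \<le> R" "0 \<le> R'" by (simp_all add: zero_le_mult_iff)
qed

lemma admissible_code:
  assumes "admissible q r R R'" "0 < \<epsilon>"
  obtains n0 where "\<And>n. n \<ge> n0 \<Longrightarrow> \<exists>P1 P2 f1 f2 g1 g2.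
     (\<Sum>j\<in>{j\<in>{1..r}. odd j}. entropy_nn (run_msg (source q n) P1 P2 f1 f2 r j)) \<le> ennreal (real n * R) \<and>
     (\<Sum>j\<in>{j\<in>{1..r}. even j}. entropy_nn (run_msg (source q n) P1 P2 f1 f2 r j)) \<le> ennreal (real n * R') \<and>
     l1_dist (run_out (source q n) P1 P2 f1 f2 g1 g2 r) (map_pmf unzip4 (iid n q)) \<le> \<epsilon>"
proof -
  have nn: "0 \<le> real n * R" "0 \<le> real n * R'" for n
    using admissible_nonneg[OF assms(1)] by simp_all
  show ?thesis
    using assms that
    unfolding admissible_def msg_law_eq out_law_eq sum_entropy_le_iff[OF nn(1)] sum_entropy_le_iff[OF nn(2)]
    by blast
qed

theorem theorem5:
  fixes q :: "('x1::finite \<times> 'x2::finite \<times> 'y1::finite \<times> 'y2::finite \<times> 'z1::finite \<times> 'z2::finite) pmf"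
    and r1 r2 :: nat and R12 R21 R12' R21' :: real
  assumes "admissible (map_pmf (\<lambda>(x1, x2, y1, y2, z1, z2). (x1, x2, z1, z2)) q) r1 R12 R21"
    and "admissible (map_pmf (\<lambda>(x1, x2, y1, y2, z1, z2). ((x1, z1), (x2, z2), y1, y2)) q) r2 R12' R21'"
  shows "admissible (map_pmf (\<lambda>(x1, x2, y1, y2, z1, z2). (x1, x2, y1, y2)) q)
           (r1 + r2) (R12 + R12') (R21 + R21')"
proof -
  define qA where "qA = map_pmf (\<lambda>(x1, x2, y1, y2, z1, z2). (x1, x2, z1, z2)) q"
  define qB where "qB = map_pmf (\<lambda>(x1, x2, y1, y2, z1, z2). ((x1, z1), (x2, z2), y1, y2)) q"
  define qC where "qC = map_pmf (\<lambda>(x1, x2, y1, y2, z1, z2). (x1, x2, y1, y2)) q"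
  have adA: "admissible qA r1 R12 R21" and adB: "admissible qB r2 R12' R21'"
    using assms by (simp_all add: qA_def qB_def)
  note nnA = admissible_nonneg[OF adA] and nnB = admissible_nonneg[OF adB]

  have srcC: "source qC n = source qA n" for n
    by (simp add: source_def qA_def qC_def iid_map map_pmf_comp comp_def case_prod_unfold)
  have srcB: "source qB n = chained_source (map_pmf unzip4 (iid n qA))" for n
    by (simp add: source_def chained_source_def qA_def qB_def iid_map map_pmf_comp comp_def case_prod_unfold
        unzip4_def zip_map_map zip_same_conv_map)
  let ?\<pi> = "\<lambda>(a1, a2, y1, y2). (map fst a1, map fst a2, y1, y2)"
  have target: "map_pmf unzip4 (iid n qC) = map_pmf ?\<pi> (map_pmf unzip4 (iid n qB))" for n
    by (simp add: qC_def qB_def iid_map map_pmf_comp comp_def case_prod_unfold unzip4_def)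
  \<comment> \<open>Fed with the true Z, the kernel is the second code on its nominal source, with Z
    then forgotten by \<open>?\<pi>\<close>.\<close>
  have kernel: "bind_pmf (map_pmf unzip4 (iid n qA)) (chained_kernel Q1 Q2 k1 k2 r2 l1 l2)
      = map_pmf ?\<pi> (run_out (source qB n) Q1 Q2 k1 k2 l1 l2 r2)" for n Q1 Q2 k1 k2 l1 l2
    by (simp add: srcB chained_source_def qA_def iid_map run_out_def chained_kernel_def
        bind_map_pmf map_pmf_def pair_pmf_def bind_assoc_pmf bind_return_pmf case_prod_unfold unzip4_def
        comp_def Let_def zip_map_map zip_same_conv_map)

  show ?thesis
    unfolding qC_def[symmetric] admissible_def
  proof (intro allI impI)
    fix \<epsilon> :: real assume \<epsilon>: "0 < \<epsilon>"
    \<comment> \<open>Error budget: \<epsilon> / 4 for each of the two given codes, and 4 \<delta> +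
      2 \<delta> \<le> \<epsilon> / 4 for making the second one robust.\<close>
    define \<delta> where "\<delta> = min 1 (\<epsilon> / 24)"
    have \<delta>: "0 < \<delta>" "\<delta> \<le> 1" "\<delta> \<le> \<epsilon> / 24" using \<epsilon> by (simp_all add: \<delta>_def)
    \<comment> \<open>The surprisal threshold per source symbol, chosen so that the probability of a
      message above it is at most \<delta>. The summand 1 keeps it positive when both rates
      vanish.\<close>
    define L where "L = (R12' + R21' + 1) / \<delta>"
    have L: "0 < L" using \<delta> nnB by (simp add: L_def)
    \<comment> \<open>A positive lower bound for whichever of the two rates are nonzero.\<close>
    define \<rho> where "\<rho> = min (if R12' = 0 then 1 else R12') (if R21' = 0 then 1 else R21')"
    have \<rho>: "0 < \<rho>" using nnB by (simp add: \<rho>_def)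
    \<comment> \<open>A bound for \<open>real r2 * L\<close> that stays positive for
      \<open>r2 = 0\<close>, so that it can be divided by.\<close>
    define u where "u = (real r2 + 1) * L"
    have u: "0 < u" using L by (simp add: u_def)
    define \<eta> where "\<eta> = min (\<epsilon> / 4) (\<delta> * \<rho> / (2 * u))"
    have "0 < \<eta>" using \<epsilon> \<delta> \<rho> u by (simp add: \<eta>_def)
    moreover have "\<eta> \<le> \<epsilon> / 4" "\<eta> \<le> \<delta> * \<rho> / (2 * u)"
      by (simp_all only: \<eta>_def min.cobounded1 min.cobounded2)
    ultimately have \<eta>: "0 < \<eta>" "\<eta> \<le> \<epsilon> / 4" "\<eta> \<le> \<delta> * \<rho> / (2 * u)" .
    have \<eta>L: "real r2 * L * \<eta> \<le> \<delta> * \<rho> / 2"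
    proof -
      have "real r2 * L * \<eta> \<le> u * (\<delta> * \<rho> / (2 * u))"
        using L u \<eta>(1) by (intro mult_mono \<eta>(3)) (simp_all add: u_def)
      also have "\<dots> = \<delta> * \<rho> / 2" using u by simp
      finally show ?thesis .
    qed
    obtain nA where nA: "\<And>n. n \<ge> nA \<Longrightarrow> \<exists>P1 P2 f1 f2 g1 g2.
        (\<Sum>j\<in>{j\<in>{1..r1}. odd j}. entropy_nn (run_msg (source qA n) P1 P2 f1 f2 r1 j)) \<le> ennreal (real n * R12) \<and>
        (\<Sum>j\<in>{j\<in>{1..r1}. even j}. entropy_nn (run_msg (source qA n) P1 P2 f1 f2 r1 j)) \<le> ennreal (real n * R21) \<and>
        l1_dist (run_out (source qA n) P1 P2 f1 f2 g1 g2 r1) (map_pmf unzip4 (iid n qA)) \<le> \<eta>"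
      using admissible_code[OF adA \<eta>(1)] by blast
    have "0 < \<epsilon> / 4" using \<epsilon> by simp
    then obtain nB where nB: "\<And>n. n \<ge> nB \<Longrightarrow> \<exists>P1 P2 f1 f2 g1 g2.
        (\<Sum>j\<in>{j\<in>{1..r2}. odd j}. entropy_nn (run_msg (source qB n) P1 P2 f1 f2 r2 j)) \<le> ennreal (real n * R12') \<and>
        (\<Sum>j\<in>{j\<in>{1..r2}. even j}. entropy_nn (run_msg (source qB n) P1 P2 f1 f2 r2 j)) \<le> ennreal (real n * R21') \<and>
        l1_dist (run_out (source qB n) P1 P2 f1 f2 g1 g2 r2) (map_pmf unzip4 (iid n qB)) \<le> \<epsilon> / 4"
      using admissible_code[OF adB] by blast
    \<comment> \<open>The last entry makes the one bit per round cost at most half of the freed rate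
      n \<delta> \<rho>. The choice of \<open>\<eta>\<close> has reserved the other half for the
      perturbation.\<close>
    define n0 where "n0 = max (max nA nB) (max 1 (nat \<lceil>2 * real r2 / (\<delta> * \<rho>)\<rceil>))"
    show "\<exists>n0. \<forall>n\<ge>n0. \<exists>P1 P2 f1 f2 g1 g2.
        (\<Sum>j\<in>{j\<in>{1..r1+r2}. odd j}. entropy_pmf (msg_law qC n P1 P2 f1 f2 (r1 + r2) j)) \<le> ereal (real n * (R12 + R12')) \<and>
        (\<Sum>j\<in>{j\<in>{1..r1+r2}. even j}. entropy_pmf (msg_law qC n P1 P2 f1 f2 (r1 + r2) j)) \<le> ereal (real n * (R21 + R21')) \<and>
        l1_dist (out_law qC n P1 P2 f1 f2 g1 g2 (r1 + r2)) (map_pmf unzip4 (iid n qC)) \<le> \<epsilon>"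
    proof (intro exI[of _ n0] allI impI)
      fix n assume n: "n0 \<le> n"
      hence n1: "n \<ge> 1" "n \<ge> nA" "n \<ge> nB" and n2: "2 * real r2 / (\<delta> * \<rho>) \<le> real n"
        unfolding n0_def by linarith+
      have nr: "real r2 \<le> real n * (\<delta> * \<rho> / 2)"
        using n2 \<delta> \<rho> by (simp add: field_simps)
      from nA[OF n1(2)] obtain P1 P2 f1 f2 g1 g2 where
        A1: "(\<Sum>j\<in>{j\<in>{1..r1}. odd j}. entropy_nn (run_msg (source qA n) P1 P2 f1 f2 r1 j)) \<le> ennreal (real n * R12)" and
        A2: "(\<Sum>j\<in>{j\<in>{1..r1}. even j}. entropy_nn (run_msg (source qA n) P1 P2 f1 f2 r1 j)) \<le> ennreal (real n * R21)" and
        A3: "l1_dist (run_out (source qA n) P1 P2 f1 f2 g1 g2 r1) (map_pmf unzip4 (iid n qA)) \<le> \<eta>"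
        by blast
      from nB[OF n1(3)] obtain P1' P2' f1' f2' g1' g2' where
        B1: "(\<Sum>j\<in>{j\<in>{1..r2}. odd j}. entropy_nn (run_msg (source qB n) P1' P2' f1' f2' r2 j)) \<le> ennreal (real n * R12')" and
        B2: "(\<Sum>j\<in>{j\<in>{1..r2}. even j}. entropy_nn (run_msg (source qB n) P1' P2' f1' f2' r2 j)) \<le> ennreal (real n * R21')" and
        B3: "l1_dist (run_out (source qB n) P1' P2' f1' f2' g1' g2' r2) (map_pmf unzip4 (iid n qB)) \<le> \<epsilon> / 4"
        by blast
      define H1 H2 b where "H1 = real n * R12'" and "H2 = real n * R21'" and "b = real n * L"
      interpret I: interactive_code "source qB n" P1' P2' f1' f2' r2 H1 H2 b \<delta>
        by unfold_locales (use B1 B2 nnB L n1 \<delta> in \<open>auto simp: H1_def H2_def b_def\<close>)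
      define Q1 Q2 where "Q1 = with_flip \<delta> P1'" and "Q2 = with_flip \<delta> P2'"
      define l1 where "l1 = (\<lambda>a m cs. g1' a (fst (prod_decode m)) (map (\<lambda>c. c - 1) cs))"
      define l2 where "l2 = (\<lambda>a m cs. g2' a (fst (prod_decode m)) (map (\<lambda>c. c - 1) cs))"
      define out1 where "out1 = run_out (source qA n) P1 P2 f1 f2 g1 g2 r1"
      have slack: "real r2 + real r2 * b * \<eta> \<le> \<delta> * (real n * R)" if "\<rho> \<le> R" for R
      proof -
        have "real r2 * b * \<eta> = real n * (real r2 * L * \<eta>)" by (simp add: b_def)
        also have "\<dots> \<le> real n * (\<delta> * \<rho> / 2)" by (rule mult_left_mono[OF \<eta>L]) simp
        finally have "real r2 + real r2 * b * \<eta> \<le> real n * (\<delta> * \<rho>)" using nr by simp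
        also have "\<dots> \<le> real n * (\<delta> * R)" using that \<delta> by (intro mult_left_mono) auto
        finally show ?thesis by (simp add: mult.left_commute)
      qed
      have dist: "l1_dist (chained_source out1) (source qB n) \<le> \<eta>"
        unfolding srcB chained_source_def out1_def by (rule order_trans[OF l1_dist_map A3])
      have E1: "(\<Sum>j\<in>{j\<in>{1..r2}. odd j}. entropy_nn (run_msg (chained_source out1) Q1 Q2 I.sifted1 I.sifted2 r2 j)) \<le> ennreal H1"
        unfolding Q1_def Q2_def
      proof (rule I.sift_entropy_sum[OF _ _ I.ent1 I.nonneg(1) _ dist])
        assume "H1 \<noteq> 0"
        thus "real r2 + real r2 * b * \<eta> \<le> \<delta> * H1"
          unfolding H1_def by (intro slack) (auto simp: \<rho>_def)
      qed (auto simp: I.silent1_def)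
      have E2: "(\<Sum>j\<in>{j\<in>{1..r2}. even j}. entropy_nn (run_msg (chained_source out1) Q1 Q2 I.sifted1 I.sifted2 r2 j)) \<le> ennreal H2"
        unfolding Q1_def Q2_def
      proof (rule I.sift_entropy_sum[OF _ _ I.ent2 I.nonneg(2) _ dist])
        assume "H2 \<noteq> 0"
        thus "real r2 + real r2 * b * \<eta> \<le> \<delta> * H2"
          unfolding H2_def by (intro slack) (auto simp: \<rho>_def)
      qed (auto simp: I.silent2_def)
      define F1 where "F1 = merge_msg r1 r2 f1 g1 I.sifted1"
      define F2 where "F2 = merge_msg r1 r2 f2 g2 I.sifted2"
      define G1 where "G1 = merge_out r1 r2 g1 l1"
      define G2 where "G2 = merge_out r1 r2 g2 l2"
      define M1 M2 where "M1 = map_pmf prod_encode (pair_pmf P1 Q1)" and "M2 = map_pmf prod_encode (pair_pmf P2 Q2)"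
      have rate: "(\<Sum>j\<in>{j\<in>{1..r1+r2}. odd j = c}. entropy_pmf (msg_law qC n M1 M2 F1 F2 (r1 + r2) j)) \<le> ereal (real n * (R + R'))"
        if "(\<Sum>j\<in>{j\<in>{1..r1}. odd j = c}. entropy_nn (run_msg (source qA n) P1 P2 f1 f2 r1 j)) \<le> ennreal (real n * R)"
          "(\<Sum>j\<in>{j\<in>{1..r2}. odd j = c}. entropy_nn (run_msg (chained_source out1) Q1 Q2 I.sifted1 I.sifted2 r2 j)) \<le> ennreal (real n * R')"
          "0 \<le> R" "0 \<le> R'" for c R R'
      proof -
        have "(\<Sum>j\<in>{j\<in>{1..r1+r2}. odd j = c}. entropy_nn (run_msg (source qA n) M1 M2 F1 F2 (r1 + r2) j))
            \<le> ennreal (real n * R) + ennreal (real n * R')"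
          using merged_entropy_sum add_mono[OF that(1,2)] unfolding M1_def M2_def F1_def F2_def out1_def
          by (rule order_trans)
        also have "\<dots> = ennreal (real n * (R + R'))"
          using that(3,4) by (simp add: distrib_left)
        finally show ?thesis
          using that(3,4) by (subst sum_entropy_le_iff) (simp_all add: msg_law_eq srcC)
      qed
      have "l1_dist (run_out (source qA n) M1 M2 F1 F2 G1 G2 (r1 + r2)) (map_pmf unzip4 (iid n qC)) \<le> \<epsilon>"
      proof -
        let ?K = "chained_kernel Q1 Q2 I.sifted1 I.sifted2 r2 l1 l2"
        let ?X = "run_out (source qB n) Q1 Q2 I.sifted1 I.sifted2 l1 l2 r2"
        let ?Y = "run_out (source qB n) P1' P2' f1' f2' g1' g2' r2"
        let ?Z = "map_pmf unzip4 (iid n qB)"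
        have run: "run_out (source qA n) M1 M2 F1 F2 G1 G2 (r1 + r2) = bind_pmf out1 ?K"
          unfolding M1_def M2_def F1_def F2_def G1_def G2_def out1_def by (rule merged_out)
        \<comment> \<open>The chain runs from the merged code to the robust code on its nominal
          source, then to the original second code, then to the target.\<close>
        have "l1_dist (bind_pmf out1 ?K) (map_pmf ?\<pi> ?X) \<le> \<eta>"
          unfolding kernel[symmetric] out1_def by (rule order_trans[OF l1_dist_bind A3])
        moreover have "l1_dist (map_pmf ?\<pi> ?X) (map_pmf ?\<pi> ?Z) \<le> l1_dist ?X ?Y + l1_dist ?Y ?Z"
          by (rule order_trans[OF l1_dist_map l1_dist_triangle])
        moreover have "l1_dist ?X ?Y \<le> 4 * \<delta> + 2 * ((H1 + H2) / b)"
          unfolding Q1_def Q2_def l1_def l2_def by (rule I.sift_out_dist)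
        moreover have "(H1 + H2) / b \<le> \<delta>"
        proof -
          have "(H1 + H2) / b = \<delta> * ((R12' + R21') / (R12' + R21' + 1))"
            using n1 by (simp add: H1_def H2_def b_def L_def flip: distrib_left)
          also have "\<dots> \<le> \<delta> * 1" using nnB \<delta> by (intro mult_left_mono) simp_all
          finally show ?thesis by simp
        qed
        moreover have "l1_dist (bind_pmf out1 ?K) (map_pmf ?\<pi> ?Z)
            \<le> l1_dist (bind_pmf out1 ?K) (map_pmf ?\<pi> ?X) + l1_dist (map_pmf ?\<pi> ?X) (map_pmf ?\<pi> ?Z)"
          by (rule l1_dist_triangle)
        ultimately show ?thesis
          unfolding run target using B3 \<eta>(2) \<delta>(3) \<epsilon> by linarith
      qed
      thus "\<exists>P1 P2 f1 f2 g1 g2.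
        (\<Sum>j\<in>{j\<in>{1..r1+r2}. odd j}. entropy_pmf (msg_law qC n P1 P2 f1 f2 (r1 + r2) j)) \<le> ereal (real n * (R12 + R12')) \<and>
        (\<Sum>j\<in>{j\<in>{1..r1+r2}. even j}. entropy_pmf (msg_law qC n P1 P2 f1 f2 (r1 + r2) j)) \<le> ereal (real n * (R21 + R21')) \<and>
        l1_dist (out_law qC n P1 P2 f1 f2 g1 g2 (r1 + r2)) (map_pmf unzip4 (iid n qC)) \<le> \<epsilon>"
        using rate[of True R12 R12'] rate[of False R21 R21'] A1 A2 E1 E2 nnA nnB
        by (intro exI[of _ M1] exI[of _ M2] exI[of _ F1] exI[of _ F2] exI[of _ G1] exI[of _ G2])
          (simp add: H1_def H2_def out_law_eq srcC)
    qed
  qed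
qed

end
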